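(* Let $n \in \mathbb{N}$ and $D > 0$. Let $(X_i, p_i)$, $i \in \mathbb{N}$, be a sequence of simply-connected pointed proper geodesic spaces and let $\Gamma_i \leq G_i \leq \mathrm{Iso}(X_i)$ be discrete groups with $\Gamma_i \cong G_i \cong \mathbb{Z}^n$ and $\mathrm{diam}(X_i/G_i) \leq D$. Assume that $$d(g p_i, p_i) \geq D \quad \text{for all } g \in \Gamma_i \setminus \{e\},$$ and that for each $i \in \mathbb{N}$ there is an isomorphism $\varphi_i : \mathbb{Z}^n \to \Gamma_i$ with $$d(\varphi_i(e_j) p_i, p_i) \leq 2D \quad \text{for all } j \in \{1, \ldots, n\}.$$ If the sequence $(X_i, p_i)$ converges in the pointed Gromov--Hausdorff sense to a space $(X,p)$, then $$\sup_i \mathrm{diam}(X_i/\Gamma_i) < \infty.$$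
   Context: A proper geodesic space is a metric space in which closed balls are compact and any two points are joined by a geodesic realizing their distance. $\mathrm{Iso}(X)$ is the isometry group of $X$ with the compact-open topology, and discreteness of subgroups refers to this topology. For a closed subgroup $G \leq \mathrm{Iso}(X)$, $X/G$ is the orbit space with the quotient metric (distance between orbits). $e_1, \ldots, e_n$ is the standard basis of $\mathbb{Z}^n$, and $e$ denotes the identity element of a group. *)

theory Defs
  imports
    "HOL-Analysis.Analysis"
    "HOL-Algebra.Bij"
    "HOL-Algebra.Elementary_Groups"
    "HOL-Algebra.Group_Action"
    "HOL-Algebra.Product_Groups"
begin

section \<open>Proper, geodesic and simply connected metric spaces\<close>

definition proper_metric :: "'a metric \<Rightarrow> bool" where
  "proper_metric X \<longleftrightarrow>
     (\<forall>x \<in> mspace X. \<forall>r. compactin (mtopology_of X) (mcball_of X x r))"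

definition geodesic_metric :: "'a metric \<Rightarrow> bool" where
  "geodesic_metric X \<longleftrightarrow>
     (\<forall>x \<in> mspace X. \<forall>y \<in> mspace X. \<exists>\<gamma>.
        \<gamma> \<in> {0..mdist X x y} \<rightarrow> mspace X \<and> \<gamma> 0 = x \<and> \<gamma> (mdist X x y) = y \<and>
        (\<forall>s \<in> {0..mdist X x y}. \<forall>t \<in> {0..mdist X x y}. mdist X (\<gamma> s) (\<gamma> t) = \<bar>s - t\<bar>))"

definition simply_connected_space :: "'a topology \<Rightarrow> bool" where
  "simply_connected_space T \<longleftrightarrow>
     path_connected_space T \<and>
     (\<forall>x \<gamma>. pathin T \<gamma> \<and> \<gamma> 0 = x \<and> \<gamma> 1 = x \<longrightarrow>
        homotopic_with (\<lambda>h. h 0 = x \<and> h 1 = x) (top_of_set {0..1}) T \<gamma> (\<lambda>_. x))"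


section \<open>The isometry group with the compact-open topology\<close>

text \<open>As in \<^const>\<open>Bij\<close>, self-maps are extensional, so that every isometry of the
  carrier is represented by exactly one HOL function.\<close>

definition isometries :: "'a metric \<Rightarrow> ('a \<Rightarrow> 'a) set" where
  "isometries X =
     {f \<in> Bij (mspace X). \<forall>x \<in> mspace X. \<forall>y \<in> mspace X. mdist X (f x) (f y) = mdist X x y}"

definition isometry_group :: "'a metric \<Rightarrow> ('a \<Rightarrow> 'a) monoid" where
  "isometry_group X = (BijGroup (mspace X))\<lparr>carrier := isometries X\<rparr>"

text \<open>The subbasic set for the empty compact set is the space of all continuous maps.\<close>

definition compact_open_topology :: "'a topology \<Rightarrow> 'b topology \<Rightarrow> ('a \<Rightarrow> 'b) topology" where
  "compact_open_topology S T =
     topology_generated_by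
       {{f \<in> extensional (topspace S). continuous_map S T f \<and> f ` K \<subseteq> U} | K U.
          compactin S K \<and> openin T U}"

definition isometry_topology :: "'a metric \<Rightarrow> ('a \<Rightarrow> 'a) topology" where
  "isometry_topology X =
     subtopology (compact_open_topology (mtopology_of X) (mtopology_of X)) (isometries X)"

definition discrete_isometries :: "'a metric \<Rightarrow> ('a \<Rightarrow> 'a) set \<Rightarrow> bool" where
  "discrete_isometries X G \<longleftrightarrow> subtopology (isometry_topology X) G = discrete_topology G"

text \<open>The following facts confirm that the encodings above are the intended objects.\<close>

lemma subgroup_isometries: "subgroup (isometries X) (BijGroup (mspace X))"
proof (rule group.subgroupI [OF group_BijGroup])
  show "isometries X \<subseteq> carrier (BijGroup (mspace X))"
    by (auto simp: isometries_def BijGroup_def)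
  have "(\<lambda>x \<in> mspace X. x) \<in> isometries X"
    by (auto simp: isometries_def id_Bij)
  then show "isometries X \<noteq> {}"
    by blast
next
  fix f assume f: "f \<in> isometries X"
  then have fB: "f \<in> Bij (mspace X)"
    by (simp add: isometries_def)
  then have bij: "bij_betw f (mspace X) (mspace X)"
    by (simp add: Bij_def)
  have "mdist X (inv_into (mspace X) f x) (inv_into (mspace X) f y) = mdist X x y"
    if "x \<in> mspace X" "y \<in> mspace X" for x y
  proof -
    have "inv_into (mspace X) f x \<in> mspace X" "inv_into (mspace X) f y \<in> mspace X"
      using that fB by (simp_all add: Bij_inv_into_mem)
    then have "mdist X (inv_into (mspace X) f x) (inv_into (mspace X) f y) =
        mdist X (f (inv_into (mspace X) f x)) (f (inv_into (mspace X) f y))"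
      using f by (simp add: isometries_def)
    also have "\<dots> = mdist X x y"
      using that bij by (simp add: bij_betw_inv_into_right)
    finally show ?thesis .
  qed
  then show "inv\<^bsub>BijGroup (mspace X)\<^esub> f \<in> isometries X"
    using fB by (simp add: inv_BijGroup isometries_def restrict_inv_into_Bij)
next
  fix f g assume f: "f \<in> isometries X" and g: "g \<in> isometries X"
  then have B: "f \<in> Bij (mspace X)" "g \<in> Bij (mspace X)"
    by (simp_all add: isometries_def)
  have "mdist X (compose (mspace X) f g x) (compose (mspace X) f g y) = mdist X x y"
    if "x \<in> mspace X" "y \<in> mspace X" for x y
  proof -
    have "g x \<in> mspace X" "g y \<in> mspace X"
      using that B(2) Bij_imp_funcset by blast+
    then show ?thesis
      using that f g by (simp add: compose_eq isometries_def)
  qed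
  then show "f \<otimes>\<^bsub>BijGroup (mspace X)\<^esub> g \<in> isometries X"
    using B by (simp add: BijGroup_def isometries_def compose_Bij)
qed

lemma group_isometry_group: "group (isometry_group X)"
  unfolding isometry_group_def
  by (rule group.subgroup_imp_group [OF group_BijGroup subgroup_isometries])

lemma topspace_isometry_topology [simp]: "topspace (isometry_topology X) = isometries X"
proof -
  have "continuous_map (mtopology_of X) (mtopology_of X) f" if "f \<in> isometries X" for f
  proof -
    have "f \<in> mspace X \<rightarrow> mspace X"
      using that by (auto simp: isometries_def dest: Bij_imp_funcset)
    moreover have "\<forall>x \<in> mspace X. \<forall>y \<in> mspace X. mdist X (f x) (f y) = mdist X x y"
      using that by (simp add: isometries_def)
    ultimately have "Lipschitz_continuous_map X X f"
      unfolding Lipschitz_continuous_map_def by (metis mult_1 order_refl image_subset_iff_funcset)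
    then show ?thesis
      by (rule Lipschitz_continuous_imp_continuous_map)
  qed
  then have "isometries X \<subseteq>
      {f \<in> extensional (topspace (mtopology_of X)).
         continuous_map (mtopology_of X) (mtopology_of X) f \<and> f ` {} \<subseteq> {}}"
    by (auto simp: isometries_def Bij_def)
  moreover have "compactin (mtopology_of X) {}" "openin (mtopology_of X) {}"
    by simp_all
  ultimately have "isometries X \<subseteq>
      topspace (compact_open_topology (mtopology_of X) (mtopology_of X))"
    unfolding compact_open_topology_def topology_generated_by_topspace by blast
  then show ?thesis
    by (auto simp: isometry_topology_def topspace_subtopology)
qed


section \<open>Orbit spaces\<close>

definition orbit_space :: "'a metric \<Rightarrow> ('a \<Rightarrow> 'a) set \<Rightarrow> 'a set set" where
  "orbit_space X G = orbits ((isometry_group X)\<lparr>carrier := G\<rparr>) (mspace X) (\<lambda>g. g)"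

definition orbit_dist :: "'a metric \<Rightarrow> 'a set \<Rightarrow> 'a set \<Rightarrow> real" where
  "orbit_dist X A B = (INF (a, b) \<in> A \<times> B. mdist X a b)"

text \<open>The diameter takes values in the extended nonnegative reals: it is \<open>\<infinity>\<close> exactly when
  the quotient is unbounded.\<close>

definition quotient_diam :: "'a metric \<Rightarrow> ('a \<Rightarrow> 'a) set \<Rightarrow> ennreal" where
  "quotient_diam X G =
     (SUP (A, B) \<in> orbit_space X G \<times> orbit_space X G. ennreal (orbit_dist X A B))"


section \<open>The group of integer vectors and its standard basis\<close>

definition Zpow :: "nat \<Rightarrow> (nat \<Rightarrow> int) monoid" where
  "Zpow n = product_group {1..n} (\<lambda>_. integer_group)"

definition Zbasis :: "nat \<Rightarrow> nat \<Rightarrow> nat \<Rightarrow> int" where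
  "Zbasis n j = (\<lambda>k \<in> {1..n}. if k = j then 1 else 0)"


section \<open>Pointed Gromov--Hausdorff convergence\<close>

text \<open>This is the definition of Burago, Burago and Ivanov: the \<open>r\<close>-balls around the base points
  admit base point preserving maps to the limit of distortion less than \<open>\<epsilon>\<close>, such that the
  \<open>\<epsilon>\<close>-neighbourhood of the image contains the \<open>(r - \<epsilon>)\<close>-ball of the limit.\<close>

definition pointed_GH_converges ::
    "(nat \<Rightarrow> 'a metric) \<Rightarrow> (nat \<Rightarrow> 'a) \<Rightarrow> 'b metric \<Rightarrow> 'b \<Rightarrow> bool" where
  "pointed_GH_converges X p Y q \<longleftrightarrow>
     (\<forall>r > 0. \<forall>\<epsilon> > 0. \<forall>\<^sub>F i in sequentially.
        \<exists>f \<in> mball_of (X i) (p i) r \<rightarrow> mspace Y.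
          f (p i) = q \<and>
          (\<forall>x \<in> mball_of (X i) (p i) r. \<forall>y \<in> mball_of (X i) (p i) r.
             \<bar>mdist Y (f x) (f y) - mdist (X i) x y\<bar> < \<epsilon>) \<and>
          (\<forall>z \<in> mball_of Y q (r - \<epsilon>). \<exists>x \<in> mball_of (X i) (p i) r. mdist Y (f x) z < \<epsilon>))"

end

theory Submission
  imports Defs "HOL-Library.Function_Algebras"
begin

text \<open>Let \<open>A \<cong> G\<^sub>i\<close> act on \<open>X\<^sub>i\<close>, and let \<open>Q = A / \<Gamma>\<^sub>i\<close>, a finite abelian group carrying the quotient of
  the orbit norm \<open>g \<mapsto> d(g p, p)\<close>. Gromov--Hausdorff convergence bounds, uniformly in \<open>i\<close>, the number
  \<open>k\<close> of translates of a ball at scale \<open>D\<close> needed to cover the ball of twice the radius; as \<open>Q\<close> is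
  abelian and coarsely geodesic, its balls then grow polynomially with degree at most \<open>k\<close>.
  If \<open>Q\<close> had huge diameter, a tent function at a scale where the volume doubles only moderately
  would have tiny Dirichlet energy, and Parseval's identity would give a nontrivial character of
  \<open>Q\<close> that is close to \<open>1\<close> on a ball of radius comparable to \<open>D\<close>. Pulled back to \<open>A\<close>, such a
  character defines a coarsely continuous map from \<open>X\<^sub>i\<close> to the circle. Since \<open>X\<^sub>i\<close> is simply connected, this
  map lifts, and the lift yields a homomorphism \<open>A \<rightarrow> \<real>\<close> inducing the same character. It is small
  and integral on the short generators of \<open>\<Gamma>\<^sub>i\<close>, hence vanishes on them, hence on \<open>\<Gamma>\<^sub>i\<close>, hence on \<open>A\<close>
  because the index is finite. So the character is trivial, a contradiction.\<close>

section \<open>Lifting coarsely continuous functions modulo 1\<close>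

text \<open>Nearby orbit points are chosen arbitrarily, so the circle-valued function on
  \<open>X\<close> is neither continuous nor equivariant. Lifting therefore tolerates jumps of 1/10,
  and each identity holds because an integer is bounded by the sum of at most four such errors,
  hence is 0. The scales are forced as follows: orbits are only 2D-dense, as the distance of two
  orbits is an infimum; a geodesic point 6D away from p then gives a group element of norm at most
  8D whose removal shortens by 4D. So the unit is r = 4D, and 2r = 8D also bounds the norm of g - h
  if g p and h p are chosen within 2D of points at distance at most 4D. The energy estimate compares
  the constant 1 - cos(pi/10) with 512 * 8^k / 4^j at scale 2^j r. It wins once j exceeds
  \<open>j\<^sub>0\<close>, provided that the last doubling multiplies the volume by at most
  2^(k+1), and a pigeonhole argument finds such a j below (k+1) \<open>j\<^sub>0\<close> + 2. Thus
  the final bound depends on k and D only. No quotient type occurs: \<open>Q\<close> is a finite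
  transversal \<open>reps\<close> in A, and its characters are written in rational coordinates with
  respect to generators of the sublattice.\<close>

definition cres :: "real \<Rightarrow> real" where
  "cres x = x - of_int (round x)"

lemma cres_diff_Ints: "cres x - x \<in> \<int>" "x - cres x \<in> \<int>"
  by (simp_all add: cres_def)

lemma abs_cres_le_half: "\<bar>cres x\<bar> \<le> 1/2"
  using of_int_round_abs_le [of x] by (simp add: cres_def abs_minus_commute)

lemma Ints_abs_less_1: "x = 0" if "x \<in> \<int>" "\<bar>x\<bar> < 1" for x :: real
  using that by (auto elim!: Ints_cases)

text \<open>\<open>\<bar>cres x\<bar>\<close> is the distance from x to the nearest integer, that
  is, the norm on the circle R/Z; the sign, triangle and congruence rules all follow from this
  minimality.\<close>

lemma cres_minimal: "\<bar>cres x\<bar> \<le> \<bar>y\<bar>" if "x - y \<in> \<int>"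
proof -
  from that obtain m where "x - y = of_int m"
    by (auto elim: Ints_cases)
  then have "y = x - of_int m"
    by simp
  then show ?thesis
    using round_diff_minimal [of x m] by (simp add: cres_def)
qed

lemma cres_unique: "cres x = y" if "x - y \<in> \<int>" "\<bar>y\<bar> < 1/2"
proof -
  have "cres x - y \<in> \<int>"
    using Ints_add [OF that(1) cres_diff_Ints(1) [of x]] by (simp add: algebra_simps)
  moreover have "\<bar>cres x - y\<bar> < 1"
    using abs_cres_le_half [of x] that(2) by linarith
  ultimately show ?thesis
    using Ints_abs_less_1 by fastforce
qed

lemma cres_0_iff: "cres x = 0 \<longleftrightarrow> x \<in> \<int>"
  using cres_diff_Ints(2) [of x] cres_unique [of x 0] by auto

lemma cres_0 [simp]: "cres 0 = 0"
  by (simp add: cres_0_iff)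

lemma abs_cres_minus: "\<bar>cres (- x)\<bar> = \<bar>cres x\<bar>"
proof -
  have "\<bar>cres (- x)\<bar> \<le> \<bar>cres x\<bar>" for x
    using cres_minimal [of "- x" "- cres x"] cres_diff_Ints(1) [of x] by (simp add: algebra_simps)
  from this [of x] this [of "- x"] show ?thesis
    by simp
qed

lemma abs_cres_triangle: "\<bar>cres (x + y)\<bar> \<le> \<bar>cres x\<bar> + \<bar>cres y\<bar>"
proof -
  have "(x - cres x) + (y - cres y) \<in> \<int>"
    by (intro Ints_add cres_diff_Ints)
  then have "x + y - (cres x + cres y) \<in> \<int>"
    by (simp add: algebra_simps)
  from cres_minimal [OF this] show ?thesis
    by linarith
qed

lemma abs_cres_cong: "\<bar>cres x\<bar> = \<bar>cres y\<bar>" if "x - y \<in> \<int>"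
proof (rule antisym)
  have "x - cres y \<in> \<int>" if "x - y \<in> \<int>" for x y
    using Ints_add [OF that cres_diff_Ints(2) [of y]] by simp
  then show "\<bar>cres x\<bar> \<le> \<bar>cres y\<bar>" "\<bar>cres y\<bar> \<le> \<bar>cres x\<bar>"
    using that Ints_minus [OF that] by (force intro: cres_minimal)+
qed

text \<open>Jumps up to 1/10 remain allowed at arbitrarily small distance. The value 1/10 keeps
  every sum of a few such errors below 1, so that an integer bounded by it must vanish.\<close>

definition coarsely_continuous_on :: "'n::metric_space set \<Rightarrow> ('n \<Rightarrow> real) \<Rightarrow> bool" where
  "coarsely_continuous_on S L \<longleftrightarrow>
     (\<exists>\<eta>>0. \<forall>x\<in>S. \<forall>y\<in>S. dist x y < \<eta> \<longrightarrow> \<bar>L x - L y\<bar> \<le> 1/10)"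

text \<open>The lift adds up small increments along the rays from a centre of \<open>S\<close>; the increments
  around a small quadrilateral sum to an integer less than \<open>1\<close> in absolute value, so they cancel.\<close>

lemma coarse_lift_convex:
  fixes S :: "'n::real_normed_vector set" and v :: "'n \<Rightarrow> real"
  assumes "convex S" and "bounded S" and "\<eta> > 0"
    and v: "\<And>x y. x \<in> S \<Longrightarrow> y \<in> S \<Longrightarrow> dist x y < \<eta> \<Longrightarrow> \<bar>cres (v x - v y)\<bar> \<le> 1/10"
  obtains L where "\<And>x. x \<in> S \<Longrightarrow> L x - v x \<in> \<int>" and "coarsely_continuous_on S L"
proof (cases "S = {}")
  case True
  show ?thesis
    by (rule that [of v]) (auto simp: True coarsely_continuous_on_def intro: exI [of _ 1])
next
  case False
  then obtain z where z: "z \<in> S"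
    by blast
  obtain B where B: "\<And>x. x \<in> S \<Longrightarrow> dist z x \<le> B"
    using \<open>bounded S\<close> bounded_any_center [of S z] by auto
  obtain N :: nat where N: "real N > B / \<eta>" "N > 0"
    using reals_Archimedean2 [of "max 0 (B / \<eta>)"] by auto
  define P where "P k x = z + (real k / real N) *\<^sub>R (x - z)" for k x
  have P_mem: "P k x \<in> S" if "x \<in> S" "k \<le> N" for k x
  proof -
    have "P k x = (1 - real k / real N) *\<^sub>R z + (real k / real N) *\<^sub>R x"
      by (simp add: P_def algebra_simps)
    moreover have "0 \<le> real k / real N" "real k / real N \<le> 1"
      using that N by auto
    ultimately show ?thesis
      using \<open>convex S\<close> z that by (simp add: convex_alt)
  qed
  have P_dist: "dist (P k x) (P k y) \<le> dist x y" if "k \<le> N" for k x y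
  proof -
    have "P k x - P k y = (real k / real N) *\<^sub>R (x - y)"
      by (simp add: P_def algebra_simps)
    then have "dist (P k x) (P k y) = (real k / real N) * dist x y"
      by (simp add: dist_norm)
    also have "\<dots> \<le> 1 * dist x y"
      using that N by (intro mult_right_mono) auto
    finally show ?thesis by simp
  qed
  have P_step: "dist (P (Suc k) x) (P k x) < \<eta>" if "x \<in> S" for k x
  proof -
    have "P (Suc k) x - P k x = (1 / real N) *\<^sub>R (x - z)"
      by (simp add: P_def scaleR_left_diff_distrib [symmetric] diff_divide_distrib [symmetric])
    then have "dist (P (Suc k) x) (P k x) = dist z x / real N"
      by (simp add: dist_norm norm_minus_commute)
    also have "\<dots> \<le> B / real N"
      using B [OF that] by (intro divide_right_mono) auto
    also have "\<dots> < \<eta>"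
      using N \<open>\<eta> > 0\<close> by (simp add: field_simps)
    finally show ?thesis .
  qed
  define c where "c k x = cres (v (P (Suc k) x) - v (P k x))" for k x
  define L where "L m x = v z + (\<Sum>k<m. c k x)" for m x
  have Lv: "L m x - v (P m x) \<in> \<int>" for m x
  proof (induction m)
    case 0
    then show ?case by (simp add: L_def P_def)
  next
    case (Suc m)
    have "L (Suc m) x - v (P (Suc m) x) =
        (L m x - v (P m x)) + (c m x - (v (P (Suc m) x) - v (P m x)))"
      by (simp add: L_def)
    then show ?case
      using Ints_add [OF Suc cres_diff_Ints(1) [of "v (P (Suc m) x) - v (P m x)"]]
      by (simp add: c_def algebra_simps)
  qed
  have LL: "L m x - L m y = cres (v (P m x) - v (P m y))"
    if "x \<in> S" "y \<in> S" "dist x y < \<eta>" "m \<le> N" for m x y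
    using \<open>m \<le> N\<close>
  proof (induction m)
    case 0
    then show ?case by (simp add: L_def P_def)
  next
    case (Suc m)
    define d where "d k = cres (v (P k x) - v (P k y))" for k
    have d_le: "\<bar>d k\<bar> \<le> 1/10" if "k \<le> N" for k
      unfolding d_def
      using P_dist [of k x y] that \<open>dist x y < \<eta>\<close> \<open>x \<in> S\<close> \<open>y \<in> S\<close> by (intro v P_mem) auto
    have c_le: "\<bar>c m w\<bar> \<le> 1/10" if "w \<in> S" for w
      unfolding c_def using P_step that Suc.prems by (intro v P_mem) auto
    have "(c m x - (v (P (Suc m) x) - v (P m x))) - (c m y - (v (P (Suc m) y) - v (P m y)))
        - (d (Suc m) - (v (P (Suc m) x) - v (P (Suc m) y))) + (d m - (v (P m x) - v (P m y))) \<in> \<int>"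
      unfolding c_def d_def by (intro Ints_add Ints_diff cres_diff_Ints)
    then have "c m x - c m y - d (Suc m) + d m \<in> \<int>"
      by (simp add: algebra_simps)
    moreover have "\<bar>c m x - c m y - d (Suc m) + d m\<bar> < 1"
      using d_le [of m] d_le [of "Suc m"] c_le [OF \<open>x \<in> S\<close>] c_le [OF \<open>y \<in> S\<close>] Suc.prems
      by linarith
    ultimately have "c m x - c m y - d (Suc m) + d m = 0"
      by (rule Ints_abs_less_1)
    moreover have "L m x - L m y = d m"
      using Suc by (simp add: d_def)
    ultimately show ?case
      by (simp add: L_def d_def)
  qed
  show thesis
  proof (rule that [of "L N"])
    show "L N x - v x \<in> \<int>" if "x \<in> S" for x
      using Lv [of N x] N by (simp add: P_def)
    show "coarsely_continuous_on S (L N)"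
      unfolding coarsely_continuous_on_def
    proof (intro exI conjI ballI impI)
      fix x y assume "x \<in> S" "y \<in> S" "dist x y < \<eta>"
      then show "\<bar>L N x - L N y\<bar> \<le> 1/10"
        using LL [of x y N] v N by (simp add: P_def)
    qed fact
  qed
qed

lemma locally_constant_on_interval:
  fixes f :: "real \<Rightarrow> 'b"
  assumes "\<eta> > 0" and "a \<le> b"
    and f: "\<And>s t. s \<in> {a..b} \<Longrightarrow> t \<in> {a..b} \<Longrightarrow> \<bar>s - t\<bar> < \<eta> \<Longrightarrow> f s = f t"
  shows "f a = f b"
proof -
  obtain N :: nat where N: "real N > (b - a) / \<eta>" "N > 0"
    using reals_Archimedean2 [of "max 0 ((b - a) / \<eta>)"] by auto
  define t where "t k = a + (real k / real N) * (b - a)" for k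
  have t_mem: "t k \<in> {a..b}" if "k \<le> N" for k
  proof -
    have "(real k / real N) * (b - a) \<le> 1 * (b - a)"
      using that N \<open>a \<le> b\<close> by (intro mult_right_mono) auto
    then show ?thesis
      using \<open>a \<le> b\<close> by (simp add: t_def)
  qed
  have "f (t k) = f a" if "k \<le> N" for k
    using that
  proof (induction k)
    case 0
    then show ?case by (simp add: t_def)
  next
    case (Suc k)
    have "t (Suc k) - t k = (b - a) / real N"
      by (simp add: t_def add_divide_distrib distrib_right)
    moreover have "(b - a) / real N < \<eta>"
      using N \<open>\<eta> > 0\<close> by (simp add: field_simps)
    moreover have "(b - a) / real N \<ge> 0"
      using \<open>a \<le> b\<close> by simp
    ultimately have "\<bar>t (Suc k) - t k\<bar> < \<eta>"
      by linarith
    then have "f (t (Suc k)) = f (t k)"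
      using Suc.prems by (intro f t_mem) auto
    then show ?case
      using Suc by simp
  qed
  from this [of N] show ?thesis
    using N by (simp add: t_def)
qed

text \<open>The difference of two lifts is integer-valued and jumps by at most 2/10 at small scale,
  so it is constant.\<close>

lemma coarse_lift_unique:
  fixes K L :: "real \<Rightarrow> real"
  assumes "coarsely_continuous_on {a..b} K" "coarsely_continuous_on {a..b} L" "a \<le> b"
    and Ints: "\<And>t. t \<in> {a..b} \<Longrightarrow> K t - L t \<in> \<int>"
  shows "K b - K a = L b - L a"
proof -
  obtain \<eta> where \<eta>: "\<eta> > 0"
    "\<And>s t. s \<in> {a..b} \<Longrightarrow> t \<in> {a..b} \<Longrightarrow> \<bar>s - t\<bar> < \<eta> \<Longrightarrow> \<bar>K s - K t\<bar> \<le> 1/10"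
    using assms(1) by (auto simp: coarsely_continuous_on_def dist_real_def)
  obtain \<theta> where \<theta>: "\<theta> > 0"
    "\<And>s t. s \<in> {a..b} \<Longrightarrow> t \<in> {a..b} \<Longrightarrow> \<bar>s - t\<bar> < \<theta> \<Longrightarrow> \<bar>L s - L t\<bar> \<le> 1/10"
    using assms(2) by (auto simp: coarsely_continuous_on_def dist_real_def)
  have "K a - L a = K b - L b"
  proof (rule locally_constant_on_interval [where f = "\<lambda>t. K t - L t" and \<eta> = "min \<eta> \<theta>"])
    fix s t assume st: "s \<in> {a..b}" "t \<in> {a..b}" "\<bar>s - t\<bar> < min \<eta> \<theta>"
    have "(K s - L s) - (K t - L t) \<in> \<int>"
      using st by (intro Ints_diff Ints)
    moreover have "\<bar>(K s - L s) - (K t - L t)\<bar> < 1"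
      using \<eta>(2) [of s t] \<theta>(2) [of s t] st by (simp add: min_def split: if_splits; linarith)
    ultimately show "K s - L s = K t - L t"
      using Ints_abs_less_1 by fastforce
  qed (use \<eta> \<theta> assms in auto)
  then show ?thesis by simp
qed

lemma coarsely_continuous_on_compose_Lipschitz:
  assumes "coarsely_continuous_on S L" and "f ` T \<subseteq> S" and "C > 0"
    and f: "\<And>x y. x \<in> T \<Longrightarrow> y \<in> T \<Longrightarrow> dist (f x) (f y) \<le> C * dist x y"
  shows "coarsely_continuous_on T (\<lambda>t. L (f t))"
proof -
  obtain \<eta> where \<eta>: "\<eta> > 0" "\<And>x y. x \<in> S \<Longrightarrow> y \<in> S \<Longrightarrow> dist x y < \<eta> \<Longrightarrow> \<bar>L x - L y\<bar> \<le> 1/10"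
    using assms(1) by (auto simp: coarsely_continuous_on_def)
  show ?thesis
    unfolding coarsely_continuous_on_def
  proof (intro exI conjI ballI impI)
    show "\<eta> / C > 0"
      using \<eta> \<open>C > 0\<close> by simp
    fix x y assume xy: "x \<in> T" "y \<in> T" "dist x y < \<eta> / C"
    have "dist (f x) (f y) \<le> C * dist x y"
      by (rule f) fact+
    also have "\<dots> < \<eta>"
      using xy \<open>C > 0\<close> by (simp add: field_simps)
    finally show "\<bar>L (f x) - L (f y)\<bar> \<le> 1/10"
      using \<eta> xy assms(2) by blast
  qed
qed

lemma mdist_self: "x \<in> mspace X \<Longrightarrow> mdist X x x = 0"
  by simp

text \<open>Heine-Cantor with a target of type \<open>'a metric\<close>: the modulus is a Lebesgue
  number of the cover by open sets on which h oscillates by less than \<epsilon>.\<close>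

lemma continuous_map_compact_uniform:
  fixes K :: "'n::metric_space set"
  assumes "compact K" and h: "continuous_map (top_of_set K) (mtopology_of X) h" and "\<epsilon> > 0"
  obtains \<eta> where "\<eta> > 0"
    "\<And>s t. s \<in> K \<Longrightarrow> t \<in> K \<Longrightarrow> dist s t < \<eta> \<Longrightarrow> mdist X (h s) (h t) < \<epsilon>"
proof -
  have hK: "h s \<in> mspace X" if "s \<in> K" for s
    using continuous_map_funspace [OF h] that by auto
  define \<U> where "\<U> = {U. open U \<and> (\<forall>s\<in>U\<inter>K. \<forall>t\<in>U\<inter>K. mdist X (h s) (h t) < \<epsilon>)}"
  have "K \<subseteq> \<Union>\<U>"
  proof
    fix s assume s: "s \<in> K"
    have "openin (mtopology_of X) (mball_of X (h s) (\<epsilon>/2))"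
      by (simp add: mtopology_of_def mball_of_def Metric_space.openin_mball)
    then have "openin (top_of_set K) {t \<in> K. h t \<in> mball_of X (h s) (\<epsilon>/2)}"
      using openin_continuous_map_preimage [OF h] by fastforce
    then obtain U where U: "open U" "{t \<in> K. h t \<in> mball_of X (h s) (\<epsilon>/2)} = K \<inter> U"
      by (auto simp: openin_open)
    have "mdist X (h a) (h b) < \<epsilon>" if "a \<in> U \<inter> K" "b \<in> U \<inter> K" for a b
    proof -
      have "a \<in> {t \<in> K. h t \<in> mball_of X (h s) (\<epsilon>/2)}" "b \<in> {t \<in> K. h t \<in> mball_of X (h s) (\<epsilon>/2)}"
        using that U(2) by blast+
      then have "mdist X (h s) (h a) < \<epsilon>/2" "mdist X (h s) (h b) < \<epsilon>/2"
        by (auto simp: in_mball_of)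
      then show ?thesis
        using mdist_triangle [of "h a" X "h s" "h b"] hK that s mdist_commute [of X "h a" "h s"] by simp
    qed
    then have "U \<in> \<U>"
      using U by (auto simp: \<U>_def)
    moreover have "s \<in> U"
    proof -
      have "s \<in> {t \<in> K. h t \<in> mball_of X (h s) (\<epsilon>/2)}"
        using s hK [OF s] \<open>\<epsilon> > 0\<close> by (simp add: in_mball_of mdist_self)
      then show ?thesis
        using U(2) by blast
    qed
    ultimately show "s \<in> \<Union>\<U>"
      by blast
  qed
  then obtain \<eta> where \<eta>: "\<eta> > 0" "\<And>x. x \<in> K \<Longrightarrow> \<exists>G \<in> \<U>. ball x \<eta> \<subseteq> G"
    using Heine_Borel_lemma [OF \<open>compact K\<close>, of \<U>] \<U>_def by (metis (no_types, lifting) mem_Collect_eq)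
  show thesis
  proof (rule that [OF \<open>\<eta> > 0\<close>])
    fix s t assume st: "s \<in> K" "t \<in> K" "dist s t < \<eta>"
    obtain G where "G \<in> \<U>" "ball s \<eta> \<subseteq> G"
      using \<eta> st by blast
    then have "s \<in> G \<inter> K" "t \<in> G \<inter> K"
      using st \<open>\<eta> > 0\<close> by (auto simp: subset_iff)
    then show "mdist X (h s) (h t) < \<epsilon>"
      using \<open>G \<in> \<U>\<close> by (auto simp: \<U>_def)
  qed
qed

section \<open>Lifting a coarse circle-valued function along maps into a simply connected
  space\<close>

context
  fixes X :: "'a metric" and u :: "'a \<Rightarrow> real" and \<epsilon> :: real
  assumes \<epsilon>: "\<epsilon> > 0"
    and u: "\<And>x y. x \<in> mspace X \<Longrightarrow> y \<in> mspace X \<Longrightarrow> mdist X x y < \<epsilon> \<Longrightarrow> \<bar>cres (u x - u y)\<bar> \<le> 1/10"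
begin

lemma coarse_lift_map:
  fixes h :: "'n::real_normed_vector \<Rightarrow> 'a"
  assumes "convex S" "compact S" and h: "continuous_map (top_of_set S) (mtopology_of X) h"
  obtains L where "\<And>x. x \<in> S \<Longrightarrow> L x - u (h x) \<in> \<int>" and "coarsely_continuous_on S L"
proof -
  obtain \<eta> where \<eta>: "\<eta> > 0"
    "\<And>s t. s \<in> S \<Longrightarrow> t \<in> S \<Longrightarrow> dist s t < \<eta> \<Longrightarrow> mdist X (h s) (h t) < \<epsilon>"
    using continuous_map_compact_uniform [OF \<open>compact S\<close> h \<epsilon>] by blast
  have hS: "h s \<in> mspace X" if "s \<in> S" for s
    using continuous_map_funspace [OF h] that by auto
  have "\<bar>cres (u (h x) - u (h y))\<bar> \<le> 1/10" if "x \<in> S" "y \<in> S" "dist x y < \<eta>" for x y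
    using that \<eta> hS by (intro u) auto
  from coarse_lift_convex [OF \<open>convex S\<close> compact_imp_bounded [OF \<open>compact S\<close>] \<open>\<eta> > 0\<close>, of "\<lambda>x. u (h x)", OF this]
  show thesis
    using that by blast
qed

text \<open>Triviality of monodromy: lift over the square of a null homotopy. Three sides are mapped
  to the base point, so the corner values of the lift agree along them, and the fourth side carries
  the loop.\<close>

lemma coarse_lift_contractible_loop:
  assumes "simply_connected_space (mtopology_of X)"
    and \<gamma>: "pathin (mtopology_of X) \<gamma>" "\<gamma> 0 = \<gamma> 1"
  obtains L where "\<And>t. t \<in> {0..1} \<Longrightarrow> L t - u (\<gamma> t) \<in> \<int>" and "coarsely_continuous_on {0..1} L"
    and "L 0 = L 1"
proof -
  let ?I = "{0..1::real}"
  have "homotopic_with (\<lambda>h. h 0 = \<gamma> 0 \<and> h 1 = \<gamma> 0) (top_of_set ?I) (mtopology_of X) \<gamma> (\<lambda>_. \<gamma> 0)"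
    using assms(1) \<gamma> unfolding simply_connected_space_def by (metis (no_types, lifting))
  then obtain h where h: "continuous_map (prod_topology (top_of_set ?I) (top_of_set ?I)) (mtopology_of X) h"
    and h0: "\<And>t. h (0, t) = \<gamma> t" and h1: "\<And>t. h (1, t) = \<gamma> 0"
    and hb: "\<And>s. s \<in> ?I \<Longrightarrow> h (s, 0) = \<gamma> 0 \<and> h (s, 1) = \<gamma> 0"
    unfolding homotopic_with_def by auto
  have h': "continuous_map (top_of_set (?I \<times> ?I)) (mtopology_of X) h"
    using h by (simp add: subtopology_Times flip: euclidean_product_topology)
  obtain L where L: "\<And>x. x \<in> ?I \<times> ?I \<Longrightarrow> L x - u (h x) \<in> \<int>"
    and cL: "coarsely_continuous_on (?I \<times> ?I) L"
    by (rule coarse_lift_map [OF _ _ h']) (auto intro: convex_Times compact_Times)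
  \<comment> \<open>On such a side a constant function is a lift as well, so uniqueness equates the
    end values of \<open>L\<close>.\<close>
  have side: "L (f 1) - L (f 0) = 0"
    if f: "f ` ?I \<subseteq> ?I \<times> ?I" "\<And>x y. dist (f x) (f y) \<le> dist x y"
      and const: "\<And>t. t \<in> ?I \<Longrightarrow> h (f t) = \<gamma> 0" for f :: "real \<Rightarrow> real \<times> real"
  proof -
    have "coarsely_continuous_on ?I (\<lambda>t. L (f t))"
      by (rule coarsely_continuous_on_compose_Lipschitz [OF cL, where C = 1]) (use f in auto)
    moreover have "coarsely_continuous_on ?I (\<lambda>t. u (\<gamma> 0))"
      by (auto simp: coarsely_continuous_on_def intro: exI [of _ 1])
    moreover have "L (f t) - u (\<gamma> 0) \<in> \<int>" if "t \<in> ?I" for t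
      using L [of "f t"] f(1) const [OF that] that by fastforce
    ultimately show ?thesis
      using coarse_lift_unique [of 0 1 "\<lambda>t. L (f t)" "\<lambda>t. u (\<gamma> 0)"] by simp
  qed
  have "L (1, 0) - L (0, 0) = 0"
    by (rule side) (use hb in \<open>auto simp: dist_Pair_Pair\<close>)
  moreover have "L (1, 1) - L (0, 1) = 0"
    by (rule side) (use hb in \<open>auto simp: dist_Pair_Pair\<close>)
  moreover have "L (1, 1) - L (1, 0) = 0"
    by (rule side) (use h1 in \<open>auto simp: dist_Pair_Pair\<close>)
  ultimately have "L (0, 0) = L (0, 1)"
    by simp
  moreover have "coarsely_continuous_on ?I (\<lambda>t. L (0, t))"
    by (rule coarsely_continuous_on_compose_Lipschitz [OF cL, where C = 1]) (auto simp: dist_Pair_Pair)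
  moreover have "L (0, t) - u (\<gamma> t) \<in> \<int>" if "t \<in> ?I" for t
    using L [of "(0, t)"] h0 that by simp
  ultimately show thesis
    using that [of "\<lambda>t. L (0, t)"] by blast
qed

text \<open>On a path of diameter below \<epsilon> the residue of u relative to the initial point is
  already a lift up to a constant, and it never exceeds 1/10; uniqueness transfers this to
  \<open>L\<close>.\<close>

lemma coarse_lift_short_path:
  fixes a b :: real
  assumes "a \<le> b" and "coarsely_continuous_on {a..b} L"
    and L: "\<And>t. t \<in> {a..b} \<Longrightarrow> L t - u (g t) \<in> \<int>"
    and g: "\<And>t. t \<in> {a..b} \<Longrightarrow> g t \<in> mspace X"
      "\<And>s t. s \<in> {a..b} \<Longrightarrow> t \<in> {a..b} \<Longrightarrow> mdist X (g s) (g t) < \<epsilon>"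
  shows "\<bar>L b - L a\<bar> \<le> 1/10"
proof -
  define K where "K t = cres (u (g t) - u (g a))" for t
  have small: "\<bar>cres (u (g s) - u (g t))\<bar> \<le> 1/10" if "s \<in> {a..b}" "t \<in> {a..b}" for s t
    using that g by (intro u) auto
  \<comment> \<open>All points of the path are pairwise close, so any modulus works; 1 is
    taken.\<close>
  have "coarsely_continuous_on {a..b} K"
    unfolding coarsely_continuous_on_def
  proof (intro exI conjI ballI impI)
    fix s t assume st: "s \<in> {a..b}" "t \<in> {a..b}"
    have "K s - K t = cres (u (g s) - u (g t))"
    proof (rule cres_unique [symmetric])
      have "((u (g s) - u (g a)) - K s) - ((u (g t) - u (g a)) - K t) \<in> \<int>"
        unfolding K_def by (intro Ints_diff cres_diff_Ints)
      then show "u (g s) - u (g t) - (K s - K t) \<in> \<int>"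
        by (simp add: algebra_simps)
      show "\<bar>K s - K t\<bar> < 1/2"
      proof -
        have "\<bar>K s\<bar> \<le> 1/10" "\<bar>K t\<bar> \<le> 1/10"
          unfolding K_def using st \<open>a \<le> b\<close> by (intro small; simp)+
        then show ?thesis
          by linarith
      qed
    qed
    then show "\<bar>K s - K t\<bar> \<le> 1/10"
      using small st by simp
  qed (rule zero_less_one)
  moreover have "L t - (u (g a) + K t) \<in> \<int>" if "t \<in> {a..b}" for t
    using Ints_diff [OF L [OF that] cres_diff_Ints(1) [of "u (g t) - u (g a)"]]
    by (simp add: K_def algebra_simps)
  ultimately have "L b - L a = (u (g a) + K b) - (u (g a) + K a)"
    using assms by (intro coarse_lift_unique) (auto simp: coarsely_continuous_on_def)
  also have "\<dots> = cres (u (g b) - u (g a))"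
    by (simp add: K_def)
  finally show ?thesis
    using small [of b a] \<open>a \<le> b\<close> by simp
qed

text \<open>\<alpha>, \<sigma> and the reverse of \<beta> form a closed triangle \<tau>, each side
  taking a third of the time. A lift of \<tau> closes up, so the increments along \<alpha> and
  \<beta> differ by that along the short side \<sigma>.\<close>

lemma path_lift_increment_eq:
  assumes "simply_connected_space (mtopology_of X)"
    and \<alpha>: "pathin (mtopology_of X) \<alpha>" and \<beta>: "pathin (mtopology_of X) \<beta>"
    and \<sigma>: "pathin (mtopology_of X) \<sigma>"
    and ends: "\<beta> 0 = \<alpha> 0" "\<sigma> 0 = \<alpha> 1" "\<sigma> 1 = \<beta> 1"
    and short: "\<And>s t. s \<in> {0..1} \<Longrightarrow> t \<in> {0..1} \<Longrightarrow> mdist X (\<sigma> s) (\<sigma> t) < \<epsilon>"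
    and K: "coarsely_continuous_on {0..1} K" "\<And>t. t \<in> {0..1} \<Longrightarrow> K t - u (\<alpha> t) \<in> \<int>"
    and L: "coarsely_continuous_on {0..1} L" "\<And>t. t \<in> {0..1} \<Longrightarrow> L t - u (\<beta> t) \<in> \<int>"
  shows "\<bar>(K 1 - K 0) - (L 1 - L 0)\<bar> \<le> 1/10"
proof -
  let ?I = "top_of_set {0..1::real}"
  define \<tau> where "\<tau> t = (if t \<le> 2/3 then if t \<le> 1/3 then \<alpha> (3 * t) else \<sigma> (3 * t - 1) else \<beta> (3 - 3 * t))"
    for t :: real
  have comp: "continuous_map (top_of_set S) (mtopology_of X) (\<lambda>t. g (f t))"
    if "pathin (mtopology_of X) g" "continuous_on S f" "f ` S \<subseteq> {0..1}" for g and f :: "real \<Rightarrow> real" and S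
    using continuous_map_compose [of "top_of_set S" ?I f "mtopology_of X" g] that
    by (auto simp: pathin_def o_def continuous_map_in_subtopology)
  have "pathin (mtopology_of X) \<tau>"
  proof -
    have "\<alpha> (3 * t) = \<sigma> (3 * t - 1)" if "t * 3 = 1" for t :: real
    proof -
      have t: "t = 1/3"
        using that by simp
      show ?thesis
        unfolding t by (simp add: ends)
    qed
    moreover have "\<sigma> (3 * t - 1) = \<beta> (3 - 3 * t)" if "t * 3 = 2" for t :: real
    proof -
      have t: "t = 2/3"
        using that by simp
      show ?thesis
        unfolding t by (simp add: ends)
    qed
    ultimately show ?thesis
      unfolding pathin_def \<tau>_def
      by (intro continuous_map_cases_le)
        (auto simp: subtopology_subtopology intro!: comp \<alpha> \<beta> \<sigma> continuous_intros)
  qed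
  moreover have "\<tau> 0 = \<tau> 1"
    by (simp add: \<tau>_def ends)
  ultimately obtain M where M: "\<And>t. t \<in> {0..1} \<Longrightarrow> M t - u (\<tau> t) \<in> \<int>"
    "coarsely_continuous_on {0..1} M" "M 0 = M 1"
    using coarse_lift_contractible_loop assms(1) by metis
  have M': "coarsely_continuous_on T (\<lambda>t. M (f t))"
    if "f ` T \<subseteq> {0..1}" "\<And>x y. \<bar>f x - f y\<bar> \<le> \<bar>x - y\<bar>" for f :: "real \<Rightarrow> real" and T
    by (rule coarsely_continuous_on_compose_Lipschitz [OF M(2), where C = 1])
      (use that in \<open>auto simp: dist_real_def\<close>)
  have "M (1 / 3) - M (0 / 3) = K 1 - K 0"
  proof (rule coarse_lift_unique [OF _ K(1)])
    show "coarsely_continuous_on {0..1} (\<lambda>t. M (t / 3))"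
      by (rule M') auto
    show "M (t / 3) - K t \<in> \<int>" if "t \<in> {0..1}" for t
      using Ints_diff [OF M(1) [of "t / 3"] K(2) [of t]] that by (auto simp: \<tau>_def)
  qed simp
  moreover have "M (1 - 1 / 3) - M (1 - 0 / 3) = L 1 - L 0"
  proof (rule coarse_lift_unique [OF _ L(1)])
    show "coarsely_continuous_on {0..1} (\<lambda>t. M (1 - t / 3))"
      by (rule M') auto
    show "M (1 - t / 3) - L t \<in> \<int>" if "t \<in> {0..1}" for t
    proof -
      have "\<tau> (1 - t / 3) = \<beta> t"
      \<comment> \<open>For t = 1 the parameter is 2/3, where \<tau> still uses the branch of
        \<sigma>; only the common end point makes both agree. The same happens at 1/3 below.\<close>
      proof (cases "t = 1")
        case True
        then show ?thesis by (simp add: \<tau>_def ends)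
      next
        case False
        then show ?thesis using that by (simp add: \<tau>_def field_simps)
      qed
      then show ?thesis
        using Ints_diff [OF M(1) [of "1 - t / 3"] L(2) [of t]] that by auto
    qed
  qed simp
  moreover have "\<bar>M ((1 + 1) / 3) - M ((0 + 1) / 3)\<bar> \<le> 1/10"
  proof (rule coarse_lift_short_path [where L = "\<lambda>t. M ((t + 1) / 3)" and g = \<sigma>])
    show "coarsely_continuous_on {0..1} (\<lambda>t. M ((t + 1) / 3))"
      by (rule M') (auto simp flip: diff_divide_distrib)
    show "M ((t + 1) / 3) - u (\<sigma> t) \<in> \<int>" if "t \<in> {0..1}" for t
    proof -
      have "\<tau> ((t + 1) / 3) = \<sigma> t"
      proof (cases "t = 0")
        case True
        then show ?thesis by (simp add: \<tau>_def ends)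
      next
        case False
        then show ?thesis using that by (simp add: \<tau>_def field_simps)
      qed
      then show ?thesis
        using M(1) [of "(t + 1) / 3"] that by auto
    qed
    show "\<sigma> t \<in> mspace X" if "t \<in> {0..1}" for t
      using continuous_map_funspace [OF \<sigma> [unfolded pathin_def]] that by auto
  qed (use short in auto)
  ultimately have "(K 1 - K 0) - (L 1 - L 0) = - (M ((1 + 1) / 3) - M ((0 + 1) / 3))"
    and "\<bar>M ((1 + 1) / 3) - M ((0 + 1) / 3)\<bar> \<le> 1/10"
    using M(3) by simp_all
  then show ?thesis
    by (simp only: abs_minus_cancel)
qed

text \<open>The lift at x is \<open>u p\<close> plus the increment along a chosen path from p to x.
  For close x and y the two chosen paths and a geodesic from x to y form a triangle with a short
  side.\<close>

lemma coarse_lift_simply_connected: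
  assumes sc: "simply_connected_space (mtopology_of X)" and geo: "geodesic_metric X"
  obtains H where "\<And>x. x \<in> mspace X \<Longrightarrow> H x - u x \<in> \<int>"
    and "\<And>x y. x \<in> mspace X \<Longrightarrow> y \<in> mspace X \<Longrightarrow> mdist X x y < \<epsilon> \<Longrightarrow> \<bar>H x - H y\<bar> \<le> 1/10"
proof (cases "mspace X = {}")
  case True
  then show ?thesis
    using that by blast
next
  case False
  then obtain p where p: "p \<in> mspace X"
    by blast
  have "\<exists>\<gamma>. pathin (mtopology_of X) \<gamma> \<and> \<gamma> 0 = p \<and> \<gamma> 1 = x" if "x \<in> mspace X" for x
    using sc p that by (auto simp: simply_connected_space_def path_connected_space_def)
  then obtain \<gamma> where \<gamma>: "\<And>x. x \<in> mspace X \<Longrightarrow> pathin (mtopology_of X) (\<gamma> x) \<and> \<gamma> x 0 = p \<and> \<gamma> x 1 = x"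
    by metis
  have "\<exists>L. (\<forall>t\<in>{0..1}. L t - u (\<gamma> x t) \<in> \<int>) \<and> coarsely_continuous_on {0..1} L"
    if "x \<in> mspace X" for x
    using coarse_lift_map [of "{0..1}" "\<gamma> x"] \<gamma> [OF that] by (metis pathin_def compact_Icc convex_real_interval(5))
  then obtain L where L: "\<And>x t. x \<in> mspace X \<Longrightarrow> t \<in> {0..1} \<Longrightarrow> L x t - u (\<gamma> x t) \<in> \<int>"
    "\<And>x. x \<in> mspace X \<Longrightarrow> coarsely_continuous_on {0..1} (L x)"
    by metis
  show thesis
  proof (rule that [of "\<lambda>x. u p + (L x 1 - L x 0)"])
    show "u p + (L x 1 - L x 0) - u x \<in> \<int>" if "x \<in> mspace X" for x
      using Ints_diff [OF L(1) [OF that, of 1] L(1) [OF that, of 0]] \<gamma> [OF that] by (simp add: algebra_simps)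
    fix x y assume xy: "x \<in> mspace X" "y \<in> mspace X" "mdist X x y < \<epsilon>"
    define d where "d = mdist X x y"
    have "0 \<le> d"
      by (simp add: d_def)
    obtain g where g: "g \<in> {0..d} \<rightarrow> mspace X" "g 0 = x" "g d = y"
      "\<And>s t. s \<in> {0..d} \<Longrightarrow> t \<in> {0..d} \<Longrightarrow> mdist X (g s) (g t) = \<bar>s - t\<bar>"
      using geo xy unfolding geodesic_metric_def d_def by meson
    have sd: "s * d \<in> {0..d}" if "s \<in> {0..1}" for s
      using that \<open>0 \<le> d\<close> by (simp add: mult_left_le_one_le)
    have gd: "mdist X (g (s * d)) (g (t * d)) = \<bar>s - t\<bar> * d" if "s \<in> {0..1}" "t \<in> {0..1}" for s t
    proof -
      have "\<bar>s * d - t * d\<bar> = \<bar>s - t\<bar> * d"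
        using \<open>0 \<le> d\<close> by (simp add: abs_mult flip: left_diff_distrib)
      then show ?thesis
        using g(4) [OF sd [OF that(1)] sd [OF that(2)]] by simp
    qed
    have "Lipschitz_continuous_map (submetric euclidean_metric {0..1}) X (\<lambda>t. g (t * d))"
      unfolding Lipschitz_continuous_map_def
    proof (intro conjI exI ballI)
      show "(\<lambda>t. g (t * d)) \<in> mspace (submetric euclidean_metric {0..1}) \<rightarrow> mspace X"
        using g(1) sd by auto
      fix s t assume "s \<in> mspace (submetric euclidean_metric {0..1::real})"
        "t \<in> mspace (submetric euclidean_metric {0..1::real})"
      then show "mdist X (g (s * d)) (g (t * d)) \<le> d * mdist (submetric euclidean_metric {0..1}) s t"
        using gd by (simp add: dist_real_def)
    qed
    then have path: "pathin (mtopology_of X) (\<lambda>t. g (t * d))"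
      using Lipschitz_continuous_imp_continuous_map by (fastforce simp: pathin_def mtopology_of_submetric)
    have "\<bar>(L x 1 - L x 0) - (L y 1 - L y 0)\<bar> \<le> 1/10"
    proof (rule path_lift_increment_eq [OF sc _ _ path])
      fix s t :: real assume st: "s \<in> {0..1}" "t \<in> {0..1}"
      then have "\<bar>s - t\<bar> * d \<le> 1 * d"
        using \<open>0 \<le> d\<close> by (intro mult_right_mono) auto
      then show "mdist X (g (s * d)) (g (t * d)) < \<epsilon>"
        using gd [OF st] xy by (simp add: d_def)
    next
      show "pathin (mtopology_of X) (\<gamma> x)" "pathin (mtopology_of X) (\<gamma> y)"
        "\<gamma> y 0 = \<gamma> x 0" "g (0 * d) = \<gamma> x 1" "g (1 * d) = \<gamma> y 1"
        using \<gamma> [OF xy(1)] \<gamma> [OF xy(2)] g by simp_all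
    qed (rule L xy; assumption?)+
    then show "\<bar>u p + (L x 1 - L x 0) - (u p + (L y 1 - L y 0))\<bar> \<le> 1/10"
      by simp
  qed
qed

end

section \<open>Characters of finite quotients\<close>

lemma frac_eq_iff_Ints: "frac x = frac y \<longleftrightarrow> x - y \<in> \<int>" for x y :: real
proof
  assume "frac x = frac y"
  then have "x - y = of_int (\<lfloor>x\<rfloor> - \<lfloor>y\<rfloor>)"
    by (simp add: frac_def)
  then show "x - y \<in> \<int>"
    by (metis Ints_of_int)
next
  assume "x - y \<in> \<int>"
  then have "(x - y) + (y - frac y) \<in> \<int>"
    by (intro Ints_add) (simp_all add: frac_def)
  then show "frac x = frac y"
    by (simp add: frac_unique_iff frac_lt_1)
qed

lemma cis_eq_1_Ints: "cis (2 * pi * x) = 1 \<longleftrightarrow> x \<in> \<int>"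
proof
  assume "cis (2 * pi * x) = 1"
  then have "cos (2 * pi * x) = 1"
    by (simp add: complex_eq_iff)
  then obtain n :: int where "2 * pi * x = of_int n * 2 * pi"
    by (auto simp: cos_one_2pi_int)
  then have "x = of_int n"
    by simp
  then show "x \<in> \<int>"
    by simp
qed simp

text \<open>A phase more than 1/20 of a turn away from 0 has an angle exceeding 2 pi / 20; this is
  the origin of the constant pi/10.\<close>

lemma cos_gap:
  assumes "\<bar>cres t\<bar> > 1/20"
  shows "1 - cos (pi/10) \<le> 1 - cos (2 * pi * t)"
proof -
  have "cos (2 * pi * t) = cos (2 * pi * cres t)"
  proof -
    have "2 * pi * t = 2 * pi * cres t + 2 * pi * of_int (round t)"
      by (simp add: cres_def algebra_simps)
    then show ?thesis
      by (simp add: cos_add)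
  qed
  also have "\<dots> = cos (2 * pi * \<bar>cres t\<bar>)"
    by (simp add: abs_if)
  also have "\<dots> \<le> cos (pi/10)"
    using assms abs_cres_le_half [of t]
    by (intro cos_monotone_0_pi_le) (auto simp: field_simps)
  finally show ?thesis
    by simp
qed

text \<open>In the application \<open>c j\<close> are the coordinates with respect to the given
  generators of \<Gamma>, extended rationally to the whole group. Elements with integral coordinates
  represent \<Gamma>, and the common denominator \<open>M\<close> makes the quotient finite.\<close>

locale rational_coordinates =
  fixes J :: "'j set" and c :: "'j \<Rightarrow> 'g::ab_group_add \<Rightarrow> real" and M :: nat
  assumes finite_J: "finite J" and M_pos: "M > 0"
    and c_add: "j \<in> J \<Longrightarrow> c j (x + y) = c j x + c j y"
    and c_denominator: "j \<in> J \<Longrightarrow> real M * c j x \<in> \<int>"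
begin

definition lat :: "'g set" where
  "lat = {x. \<forall>j\<in>J. c j x \<in> \<int>}"

definition key :: "'g \<Rightarrow> 'j \<Rightarrow> real" where
  "key x = (\<lambda>j\<in>J. frac (c j x))"

text \<open>Choosing through \<open>key\<close>, a complete invariant of the coset, makes the
  representative depend on the coset only.\<close>

definition rep :: "'g \<Rightarrow> 'g" where
  "rep x = (SOME y. key y = key x)"

definition reps :: "'g set" where
  "reps = range rep"

definition freq :: "('j \<Rightarrow> nat) \<Rightarrow> 'g \<Rightarrow> real" where
  "freq a x = (\<Sum>j\<in>J. real (a j) * c j x)"

definition chr :: "('j \<Rightarrow> nat) \<Rightarrow> 'g \<Rightarrow> complex" where
  "chr a x = cis (2 * pi * freq a x)"

text \<open>The quotient embeds into the M-torsion of a torus, so this cube yields its characters,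
  possibly with repetition. The repetition is harmless: the whole cube is summed, and it makes
  orthogonality factor over the coordinates.\<close>

abbreviation freqs :: "('j \<Rightarrow> nat) set" where
  "freqs \<equiv> J \<rightarrow>\<^sub>E {..<M}"

lemma c_zero: "j \<in> J \<Longrightarrow> c j 0 = 0"
  using c_add [of j 0 0] by simp

lemma c_minus: "j \<in> J \<Longrightarrow> c j (- x) = - c j x"
  using c_add [of j x "- x"] c_zero by simp

lemma c_diff: "j \<in> J \<Longrightarrow> c j (x - y) = c j x - c j y"
  using c_add [of j x "- y"] c_minus by simp

lemma lat_zero: "0 \<in> lat"
  by (simp add: lat_def c_zero)

lemma lat_add: "x \<in> lat \<Longrightarrow> y \<in> lat \<Longrightarrow> x + y \<in> lat"
  by (simp add: lat_def c_add)

lemma lat_minus: "x \<in> lat \<Longrightarrow> - x \<in> lat"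
  by (simp add: lat_def c_minus)

lemma lat_diff: "x \<in> lat \<Longrightarrow> y \<in> lat \<Longrightarrow> x - y \<in> lat"
  using lat_add [of x "- y"] lat_minus by simp

lemma key_eq_iff: "key x = key y \<longleftrightarrow> x - y \<in> lat"
proof -
  have "key x = key y \<longleftrightarrow> (\<forall>j\<in>J. frac (c j x) = frac (c j y))"
    unfolding key_def restrict_def fun_eq_iff by auto
  then show ?thesis
    by (simp add: lat_def c_diff frac_eq_iff_Ints)
qed

lemma key_rep: "key (rep x) = key x"
  unfolding rep_def by (rule someI) (rule refl)

lemma rep_diff: "rep x - x \<in> lat"
  using key_rep key_eq_iff by blast

lemma rep_eq_iff: "rep x = rep y \<longleftrightarrow> x - y \<in> lat"
proof
  assume "rep x = rep y"
  then have "key x = key y"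
    using key_rep [of x] key_rep [of y] by simp
  then show "x - y \<in> lat"
    by (simp add: key_eq_iff)
qed (simp add: rep_def key_eq_iff [symmetric])

lemma rep_mem: "rep x \<in> reps"
  by (simp add: reps_def)

lemma rep_reps: "x \<in> reps \<Longrightarrow> rep x = x"
  using rep_diff rep_eq_iff by (auto simp: reps_def)

lemma reps_eq_iff: "x \<in> reps \<Longrightarrow> y \<in> reps \<Longrightarrow> x - y \<in> lat \<longleftrightarrow> x = y"
  using rep_eq_iff rep_reps by metis

text \<open>The denominator \<open>M\<close> leaves only i/M with i < M as entries of a key, and
  representatives are determined by keys.\<close>

lemma finite_reps: "finite reps"
proof -
  have "key x \<in> J \<rightarrow>\<^sub>E (\<lambda>i. real i / real M) ` {..<M}" for x
    unfolding key_def restrict_PiE_iff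
  proof
    fix j assume j: "j \<in> J"
    obtain m where m: "real M * c j x = of_int m"
      using c_denominator [OF j] by (auto elim: Ints_cases)
    define i where "i = m - of_nat M * \<lfloor>c j x\<rfloor>"
    have i: "real M * frac (c j x) = of_int i"
      using m by (simp add: i_def frac_def algebra_simps)
    have "real M * frac (c j x) \<ge> 0" "real M * frac (c j x) < real M * 1"
      using M_pos frac_ge_0 [of "c j x"] frac_lt_1 [of "c j x"]
      by (simp, intro mult_strict_left_mono) auto
    then have "0 \<le> i" "i < int M"
      by (simp_all add: i)
    then have "nat i < M" and "real (nat i) = real M * frac (c j x)"
      using i by simp_all
    then have "frac (c j x) = real (nat i) / real M" "nat i < M"
      using M_pos by simp_all
    then show "frac (c j x) \<in> (\<lambda>i. real i / real M) ` {..<M}"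
      by blast
  qed
  then have "range key \<subseteq> J \<rightarrow>\<^sub>E (\<lambda>i. real i / real M) ` {..<M}"
    by blast
  then have "finite (range key)"
    using finite_J by (meson finite_PiE finite_imageI finite_lessThan finite_subset)
  moreover have "reps = (\<lambda>k. SOME y. key y = k) ` range key"
    by (simp add: reps_def rep_def image_image)
  ultimately show ?thesis
    by simp
qed

text \<open>Translation by s followed by \<open>rep\<close> permutes the transversal: this is
  invariance of counting measure on the quotient.\<close>

lemma sum_reps_shift:
  assumes f: "\<And>x l. l \<in> lat \<Longrightarrow> f (x + l) = f x"
  shows "(\<Sum>x\<in>reps. f (x + s)) = (\<Sum>x\<in>reps. f x)"
proof -
  have frep: "f (rep x) = f x" for x
    using f [OF rep_diff, of x x] by simp
  have bij: "bij_betw (\<lambda>x. rep (x + s)) reps reps"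
    unfolding bij_betw_def
  proof
    show "inj_on (\<lambda>x. rep (x + s)) reps"
      by (auto simp: inj_on_def rep_eq_iff reps_eq_iff)
    show "(\<lambda>x. rep (x + s)) ` reps = reps"
    proof
      show "reps \<subseteq> (\<lambda>x. rep (x + s)) ` reps"
      proof
        fix y assume y: "y \<in> reps"
        have "rep (rep (y - s) + s) = rep y"
          using rep_diff [of "y - s"] by (simp add: rep_eq_iff algebra_simps)
        then show "y \<in> (\<lambda>x. rep (x + s)) ` reps"
          using y rep_reps rep_mem by (metis imageI)
      qed
    qed (auto simp: rep_mem)
  qed
  have "(\<Sum>x\<in>reps. f (x + s)) = (\<Sum>x\<in>reps. f (rep (x + s)))"
    by (simp add: frep)
  also have "\<dots> = (\<Sum>x\<in>reps. f x)"
    by (rule sum.reindex_bij_betw [OF bij])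
  finally show ?thesis .
qed

lemma freq_add: "freq a (x + y) = freq a x + freq a y"
  by (simp add: freq_def c_add distrib_left sum.distrib)

lemma freq_minus: "freq a (- x) = - freq a x"
  by (simp add: freq_def c_minus sum_negf)

lemma freq_diff: "freq a (x - y) = freq a x - freq a y"
  using freq_add [of a x "- y"] freq_minus by simp

lemma freq_lat: "l \<in> lat \<Longrightarrow> freq a l \<in> \<int>"
  by (auto simp: freq_def lat_def)

lemma chr_add: "chr a (x + y) = chr a x * chr a y"
  by (simp add: chr_def freq_add cis_mult distrib_left)

lemma cnj_chr: "cnj (chr a x) = chr a (- x)"
  by (simp add: chr_def cis_cnj freq_minus)

lemma chr_lat: "l \<in> lat \<Longrightarrow> chr a l = 1"
  by (simp add: chr_def freq_lat)

text \<open>Orthogonality summed over characters instead of group elements. The sum splits into one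
  geometric sum per coordinate, whose ratio is an \<open>M\<close>-th root of unity and equals 1
  exactly if that coordinate is integral.\<close>

lemma chr_orthogonality:
  "(\<Sum>a\<in>freqs. chr a x) = (if x \<in> lat then of_nat (M ^ card J) else 0)"
proof -
  define w where "w j = cis (2 * pi * c j x)" for j
  have "chr a x = (\<Prod>j\<in>J. w j ^ a j)" for a
  proof -
    have "(\<Prod>j\<in>J. w j ^ a j) = cis (\<Sum>j\<in>J. real (a j) * (2 * pi * c j x))"
    proof -
      have "w j ^ a j = cis (real (a j) * (2 * pi * c j x))" for j
        unfolding w_def by (rule Complex.DeMoivre)
      moreover have "(\<Prod>j\<in>J. cis (f j)) = cis (\<Sum>j\<in>J. f j)" for f
        using finite_J by (induction J rule: finite_induct) (simp_all add: cis_mult)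
      ultimately show ?thesis
        by simp
    qed
    then show ?thesis
      by (simp add: chr_def freq_def sum_distrib_left mult_ac)
  qed
  then have "(\<Sum>a\<in>freqs. chr a x) = (\<Prod>j\<in>J. \<Sum>k<M. w j ^ k)"
    by (simp add: prod_sum_PiE finite_J)
  moreover have "(\<Sum>k<M. w j ^ k) = (if c j x \<in> \<int> then of_nat M else 0)" if "j \<in> J" for j
  proof (cases "c j x \<in> \<int>")
    case True
    then have "w j = 1"
      by (simp add: w_def)
    then show ?thesis
      using True by simp
  next
    case False
    then have "w j \<noteq> 1"
      by (simp add: w_def cis_eq_1_Ints)
    moreover have "w j ^ M = 1"
    proof -
      have "w j ^ M = cis (2 * pi * (real M * c j x))"
        unfolding w_def Complex.DeMoivre by (simp add: mult_ac)
      then show ?thesis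
        by (simp add: cis_eq_1_Ints c_denominator that)
    qed
    ultimately show ?thesis
      using False by (simp add: geometric_sum)
  qed
  moreover have "(\<Prod>j\<in>J. if c j x \<in> \<int> then of_nat M else 0) =
      (if x \<in> lat then of_nat (M ^ card J) else (0::complex))"
    using finite_J by (auto simp: lat_def intro: prod_zero)
  ultimately show ?thesis
    by simp
qed

text \<open>Expand the square and sum over a before x and y; orthogonality leaves the diagonal. The
  factor is the size of the cube of frequencies rather than that of the quotient, since characters
  may repeat.\<close>

lemma Parseval:
  fixes \<psi> :: "'g \<Rightarrow> real"
  shows "(\<Sum>a\<in>freqs. (cmod (\<Sum>x\<in>reps. of_real (\<psi> x) * chr a x))\<^sup>2)
    = real (M ^ card J) * (\<Sum>x\<in>reps. (\<psi> x)\<^sup>2)"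
proof -
  have "complex_of_real (\<Sum>a\<in>freqs. (cmod (\<Sum>x\<in>reps. of_real (\<psi> x) * chr a x))\<^sup>2)
      = (\<Sum>a\<in>freqs. \<Sum>x\<in>reps. \<Sum>y\<in>reps. of_real (\<psi> x * \<psi> y) * chr a (x - y))"
    unfolding of_real_sum complex_norm_square cnj_sum sum_product
    by (intro sum.cong refl) (simp add: cnj_chr mult_ac chr_add [symmetric])
  also have "\<dots> = (\<Sum>x\<in>reps. \<Sum>y\<in>reps. \<Sum>a\<in>freqs. of_real (\<psi> x * \<psi> y) * chr a (x - y))"
    by (subst sum.swap) (intro sum.cong refl sum.swap)
  also have "\<dots> = (\<Sum>x\<in>reps. \<Sum>y\<in>reps. of_real (\<psi> x * \<psi> y) * (if x = y then of_nat (M ^ card J) else 0))"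
    by (intro sum.cong refl) (simp add: sum_distrib_left [symmetric] chr_orthogonality reps_eq_iff)
  also have "\<dots> = (\<Sum>x\<in>reps. \<Sum>y\<in>reps. if y = x then of_real (\<psi> x * \<psi> x) * of_nat (M ^ card J) else 0)"
    by (intro sum.cong refl) auto
  also have "\<dots> = complex_of_real (real (M ^ card J) * (\<Sum>x\<in>reps. (\<psi> x)\<^sup>2))"
    by (simp add: finite_reps power2_eq_square sum_distrib_left mult_ac)
  finally show ?thesis
    unfolding of_real_eq_iff .
qed

lemma Fourier_shift:
  fixes \<psi> :: "'g \<Rightarrow> real"
  assumes \<psi>: "\<And>x l. l \<in> lat \<Longrightarrow> \<psi> (x + l) = \<psi> x"
  shows "(\<Sum>x\<in>reps. of_real (\<psi> (x + s) - \<psi> x) * chr a x)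
    = (chr a (- s) - 1) * (\<Sum>x\<in>reps. of_real (\<psi> x) * chr a x)"
proof -
  have "(\<Sum>x\<in>reps. of_real (\<psi> (x + s)) * chr a x)
      = chr a (- s) * (\<Sum>x\<in>reps. of_real (\<psi> (x + s)) * chr a (x + s))"
    by (simp add: sum_distrib_left chr_add [symmetric] mult_ac chr_add [of _ "- s", symmetric])
  also have "(\<Sum>x\<in>reps. of_real (\<psi> (x + s)) * chr a (x + s)) = (\<Sum>x\<in>reps. of_real (\<psi> x) * chr a x)"
    by (rule sum_reps_shift [where f = "\<lambda>x. of_real (\<psi> x) * chr a x"]) (simp add: \<psi> chr_add chr_lat)
  finally show ?thesis
    by (simp add: left_diff_distrib sum_subtractf)
qed

lemma chr_minus_1_norm: "(cmod (chr a (- s) - 1))\<^sup>2 = 2 - 2 * cos (2 * pi * freq a s)"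
proof -
  have "(cmod (chr a (- s) - 1))\<^sup>2 = (cos (2 * pi * freq a s) - 1)\<^sup>2 + (sin (2 * pi * freq a s))\<^sup>2"
    by (simp add: chr_def freq_minus cmod_power2)
  also have "\<dots> = 2 - 2 * cos (2 * pi * freq a s)"
    using sin_cos_squared_add [of "2 * pi * freq a s"] by (simp add: power2_diff)
  finally show ?thesis .
qed

end

section \<open>Moderate volume growth forces a low nontrivial frequency\<close>

locale periodic_norm = rational_coordinates J c M
  for J :: "'j set" and c :: "'j \<Rightarrow> 'g::ab_group_add \<Rightarrow> real" and M +
  fixes nq :: "'g \<Rightarrow> real"
  assumes nq_lat: "l \<in> lat \<Longrightarrow> nq (x + l) = nq x"
    and nq_nonneg: "nq x \<ge> 0"
    and nq_zero: "nq 0 = 0"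
    and nq_minus: "nq (- x) = nq x"
    and nq_add: "nq (x + y) \<le> nq x + nq y"
begin

definition nball :: "real \<Rightarrow> 'g set" where
  "nball t = {x \<in> reps. nq x \<le> t}"

lemma finite_nball: "finite (nball t)"
  by (simp add: nball_def finite_reps)

lemma nq_rep: "nq (rep x) = nq x"
  using nq_lat [OF rep_diff, of x x] by simp

lemma nq_diff_le: "nq (x - y) \<le> nq x + nq y"
  using nq_add [of x "- y"] nq_minus by simp

lemma abs_nq_diff_le: "\<bar>nq (x + s) - nq x\<bar> \<le> nq s"
  using nq_add [of x s] nq_diff_le [of "x + s" s] by simp

lemma rep_zero_mem: "t \<ge> 0 \<Longrightarrow> rep 0 \<in> nball t"
  by (simp add: nball_def rep_mem nq_rep nq_zero)

lemma nball_pos: "t \<ge> 0 \<Longrightarrow> card (nball t) > 0"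
  using rep_zero_mem finite_nball card_gt_0_iff by blast

lemma nball_mono: "s \<le> t \<Longrightarrow> card (nball s) \<le> card (nball t)"
  by (rule card_mono [OF finite_nball]) (auto simp: nball_def)

text \<open>The ball and its translate by z are disjoint. This makes the support of a tent of radius
  W at most half of the quotient, as centring requires.\<close>

lemma two_disjoint_balls:
  assumes "nq z > 2 * W"
  shows "2 * card (nball W) \<le> card reps"
proof -
  let ?f = "\<lambda>x. rep (x + z)"
  have "inj_on ?f (nball W)"
    by (auto simp: inj_on_def nball_def rep_eq_iff reps_eq_iff)
  moreover have "nball W \<inter> ?f ` nball W = {}"
  proof -
    have "nq (?f x) > W" if "x \<in> nball W" for x
      using nq_diff_le [of "x + z" x] that assms by (simp add: nball_def nq_rep)
    then show ?thesis
      by (force simp: nball_def)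
  qed
  moreover have "nball W \<union> ?f ` nball W \<subseteq> reps"
    by (auto simp: nball_def rep_mem)
  ultimately show ?thesis
    using card_mono [OF finite_reps, of "nball W \<union> ?f ` nball W"]
    by (simp add: card_Un_disjoint finite_nball card_image)
qed

lemma sum_tent_squares_ge:
  assumes "W > 0"
  shows "(W/2)\<^sup>2 * card (nball (W/2)) \<le> (\<Sum>x\<in>reps. (max 0 (W - nq x))\<^sup>2)"
proof -
  have "(W/2)\<^sup>2 * card (nball (W/2)) = (\<Sum>x\<in>nball (W/2). (W/2)\<^sup>2)"
    by simp
  also have "\<dots> \<le> (\<Sum>x\<in>nball (W/2). (max 0 (W - nq x))\<^sup>2)"
    using assms by (intro sum_mono power_mono) (auto simp: nball_def)
  also have "\<dots> \<le> (\<Sum>x\<in>reps. (max 0 (W - nq x))\<^sup>2)"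
    by (rule sum_mono2 [OF finite_reps]) (auto simp: nball_def)
  finally show ?thesis .
qed

text \<open>The tent is 1-Lipschitz, so each increment is at most t, and it vanishes unless x or x +
  s lies in the ball; these two cases give the factor 2.\<close>

lemma sum_tent_increment_le:
  assumes "nq s \<le> t"
  shows "(\<Sum>x\<in>reps. (max 0 (W - nq (x + s)) - max 0 (W - nq x))\<^sup>2) \<le> 2 * t\<^sup>2 * card (nball W)"
proof -
  have "0 \<le> t"
    using assms nq_nonneg [of s] by linarith
  have "(max 0 (W - nq (x + s)) - max 0 (W - nq x))\<^sup>2
      \<le> t\<^sup>2 * (of_bool (nq (x + s) \<le> W) + of_bool (nq x \<le> W))" for x
  proof (cases "nq (x + s) \<le> W \<or> nq x \<le> W")
    case True
    have "\<bar>max 0 (W - nq (x + s)) - max 0 (W - nq x)\<bar> \<le> \<bar>t\<bar>"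
      using abs_nq_diff_le [of x s] assms by linarith
    then have "(max 0 (W - nq (x + s)) - max 0 (W - nq x))\<^sup>2 \<le> t\<^sup>2 * 1"
      by (simp add: abs_le_square_iff)
    also have "\<dots> \<le> t\<^sup>2 * (of_bool (nq (x + s) \<le> W) + of_bool (nq x \<le> W))"
      using True by (intro mult_left_mono) auto
    finally show ?thesis .
  next
    case False
    then show ?thesis
      by (simp add: max_def)
  qed
  then have "(\<Sum>x\<in>reps. (max 0 (W - nq (x + s)) - max 0 (W - nq x))\<^sup>2)
      \<le> (\<Sum>x\<in>reps. t\<^sup>2 * (of_bool (nq (x + s) \<le> W) + of_bool (nq x \<le> W)))"
    by (rule sum_mono)
  also have "\<dots> = t\<^sup>2 * ((\<Sum>x\<in>reps. of_bool (nq (x + s) \<le> W)) + (\<Sum>x\<in>reps. of_bool (nq x \<le> W)))"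
    by (simp only: sum_distrib_left [symmetric] sum.distrib)
  also have "(\<Sum>x\<in>reps. of_bool (nq (x + s) \<le> W)) = (\<Sum>x\<in>reps. of_bool (nq x \<le> W) :: real)"
    by (rule sum_reps_shift [where f = "\<lambda>x. of_bool (nq x \<le> W)"]) (simp add: nq_lat)
  also have "(\<Sum>x\<in>reps. of_bool (nq x \<le> W) :: real) = card (nball W)"
  proof -
    have "(\<Sum>x\<in>reps. of_bool (nq x \<le> W) :: real) = (\<Sum>x\<in>nball W. 1)"
      by (rule sum.mono_neutral_cong_right [OF finite_reps]) (auto simp: nball_def)
    then show ?thesis
      by simp
  qed
  finally show ?thesis
    by (simp add: mult_ac)
qed

text \<open>A function supported on at most half of the group has, by Cauchy-Schwarz, at most half
  of its square mass in its mean, so subtracting the mean costs a factor 2 at most.\<close>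

lemma sum_centred_tent_squares_ge:
  fixes W :: real
  assumes "2 * card (nball W) \<le> card reps"
  defines "\<phi> \<equiv> \<lambda>x. max 0 (W - nq x)"
  defines "\<mu> \<equiv> (\<Sum>x\<in>reps. \<phi> x) / card reps"
  shows "(\<Sum>x\<in>reps. (\<phi> x)\<^sup>2) \<le> 2 * (\<Sum>x\<in>reps. (\<phi> x - \<mu>)\<^sup>2)"
proof -
  define S where "S = (\<Sum>x\<in>reps. \<phi> x)"
  have Q: "real (card reps) > 0"
    using finite_reps rep_mem card_gt_0_iff by auto
  have "S = (\<Sum>x\<in>nball W. 1 * \<phi> x)"
    unfolding S_def by (rule sum.mono_neutral_cong_right [OF finite_reps]) (auto simp: nball_def \<phi>_def)
  then have "S\<^sup>2 \<le> (\<Sum>x\<in>nball W. 1\<^sup>2) * (\<Sum>x\<in>nball W. (\<phi> x)\<^sup>2)"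
    by (simp only: Cauchy_Schwarz_ineq_sum)
  also have "(\<Sum>x\<in>nball W. (\<phi> x)\<^sup>2) = (\<Sum>x\<in>reps. (\<phi> x)\<^sup>2)"
    by (rule sum.mono_neutral_cong_left [OF finite_reps]) (auto simp: nball_def \<phi>_def)
  finally have S2: "S\<^sup>2 \<le> card (nball W) * (\<Sum>x\<in>reps. (\<phi> x)\<^sup>2)"
    by simp
  have "2 * S\<^sup>2 \<le> (2 * card (nball W)) * (\<Sum>x\<in>reps. (\<phi> x)\<^sup>2)"
    using S2 by simp
  also have "\<dots> \<le> card reps * (\<Sum>x\<in>reps. (\<phi> x)\<^sup>2)"
    using assms(1) by (intro mult_right_mono sum_nonneg) (auto simp flip: of_nat_le_iff)
  finally have "2 * (S\<^sup>2 / card reps) \<le> (\<Sum>x\<in>reps. (\<phi> x)\<^sup>2)"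
    using Q by (simp add: field_simps)
  moreover have "(\<Sum>x\<in>reps. (\<phi> x - \<mu>)\<^sup>2) = (\<Sum>x\<in>reps. (\<phi> x)\<^sup>2) - S\<^sup>2 / card reps"
  proof -
    have "(\<Sum>x\<in>reps. (\<phi> x - \<mu>)\<^sup>2) = (\<Sum>x\<in>reps. (\<phi> x)\<^sup>2) - 2 * \<mu> * S + card reps * \<mu>\<^sup>2"
      by (simp add: power2_diff sum.distrib sum_subtractf S_def sum_distrib_left mult_ac)
    also have "\<dots> = (\<Sum>x\<in>reps. (\<phi> x)\<^sup>2) - S\<^sup>2 / card reps"
    proof -
      have "\<mu> * card reps = S"
        using Q by (simp add: \<mu>_def S_def)
      then have "S\<^sup>2 / card reps = \<mu> * S" "card reps * \<mu>\<^sup>2 = \<mu> * S"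
        using Q by (auto simp: power2_eq_square field_simps)
      then show ?thesis
        by simp
    qed
    finally show ?thesis .
  qed
  ultimately show ?thesis
    by simp
qed

text \<open>If every doubling after \<open>j\<^sub>0\<close> up to J multiplied the volume by more
  than 2^(k+1), the growth bound would give (k+1)(J - \<open>j\<^sub>0\<close>) \<le> kJ, that is J
  \<le> (k+1) \<open>j\<^sub>0\<close>. The range ends one step beyond this.\<close>

lemma doubling_scale:
  fixes k j\<^sub>0 :: nat and r :: real
  assumes "r > 0" and "j\<^sub>0 \<ge> 1"
    and growth: "\<And>j. j \<ge> 1 \<Longrightarrow> card (nball (2^j * r)) \<le> (2^j)^k * card (nball (2 * r))"
  obtains j where "j\<^sub>0 < j" "j \<le> (k + 1) * j\<^sub>0 + 1"
    "card (nball (2^j * r)) \<le> 2^(k + 1) * card (nball (2^j * r / 2))"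
proof (rule ccontr)
  assume not: "\<not> thesis"
  note scale = that
  define J\<^sub>0 where "J\<^sub>0 = (k + 1) * j\<^sub>0 + 1"
  have "(2^(k + 1))^i * card (nball (2^j\<^sub>0 * r)) \<le> card (nball (2^(j\<^sub>0 + i) * r))" if "j\<^sub>0 + i \<le> J\<^sub>0" for i
    using that
  proof (induction i)
    case 0
    then show ?case by simp
  next
    case (Suc i)
    have "2^(k + 1) * card (nball (2^(j\<^sub>0 + Suc i) * r / 2)) < card (nball (2^(j\<^sub>0 + Suc i) * r))"
      using not scale [of "j\<^sub>0 + Suc i"] Suc.prems unfolding J\<^sub>0_def not_le [symmetric] by linarith
    then have "2^(k + 1) * card (nball (2^(j\<^sub>0 + i) * r)) \<le> card (nball (2^(j\<^sub>0 + Suc i) * r))"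
      by simp
    moreover have "2^(k + 1) * ((2^(k + 1))^i * card (nball (2^j\<^sub>0 * r))) \<le> 2^(k + 1) * card (nball (2^(j\<^sub>0 + i) * r))"
      using Suc by (intro mult_left_mono) auto
    ultimately have "2^(k + 1) * ((2^(k + 1))^i * card (nball (2^j\<^sub>0 * r))) \<le> card (nball (2^(j\<^sub>0 + Suc i) * r))"
      by (rule order_trans [rotated])
    then show ?case
      by (simp only: power_Suc mult.assoc)
  qed
  from this [of "J\<^sub>0 - j\<^sub>0"]
  have "(2^(k + 1))^(J\<^sub>0 - j\<^sub>0) * card (nball (2^j\<^sub>0 * r)) \<le> card (nball (2^J\<^sub>0 * r))"
    by (simp add: J\<^sub>0_def)
  also have "\<dots> \<le> (2^J\<^sub>0)^k * card (nball (2 * r))"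
    by (rule growth) (simp add: J\<^sub>0_def)
  also have "\<dots> \<le> (2^J\<^sub>0)^k * card (nball (2^j\<^sub>0 * r))"
  proof (intro mult_left_mono nball_mono)
    have "(2::real)^1 \<le> 2^j\<^sub>0"
      using \<open>j\<^sub>0 \<ge> 1\<close> by (intro power_increasing) auto
    then show "2 * r \<le> 2^j\<^sub>0 * r"
      using \<open>r > 0\<close> by simp
  qed simp
  finally have "((2::nat)^(k + 1))^(J\<^sub>0 - j\<^sub>0) \<le> (2^J\<^sub>0)^k"
    using nball_pos [of "2^j\<^sub>0 * r"] \<open>r > 0\<close> by simp
  then have "(k + 1) * (J\<^sub>0 - j\<^sub>0) \<le> J\<^sub>0 * k"
    by (simp only: power_mult [symmetric] power_increasing_iff)
  moreover have "J\<^sub>0 - j\<^sub>0 = k * j\<^sub>0 + 1" "J\<^sub>0 = k * j\<^sub>0 + 1 + j\<^sub>0"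
    by (simp_all add: J\<^sub>0_def)
  ultimately show False
    by (simp add: algebra_simps)
qed

text \<open>If g had phase above 1/10, then for each s in the ball of radius 2r one of s and s + g
  would have phase above 1/20. These exceptional elements and a translate of them would cover that
  ball, so they would number at least half of it.\<close>

lemma small_frequency_of_mostly_small:
  assumes "r \<ge> 0"
    and most: "2 * card {s \<in> nball (4 * r). \<bar>cres (freq a s)\<bar> > 1/20} < card (nball (2 * r))"
    and g: "nq g \<le> 2 * r"
  shows "\<bar>cres (freq a g)\<bar> \<le> 1/10"
proof (rule ccontr)
  assume not: "\<not> ?thesis"
  define bad where "bad = {s \<in> nball (4 * r). \<bar>cres (freq a s)\<bar> > 1/20}"
  have fin: "finite bad"
    by (simp add: bad_def finite_nball)
  have "s \<in> bad \<or> rep (s + g) \<in> bad" if s: "s \<in> nball (2 * r)" for s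
  proof -
    have mem: "s \<in> nball (4 * r)" "rep (s + g) \<in> nball (4 * r)"
      using s g nq_add [of s g] \<open>r \<ge> 0\<close> by (auto simp: nball_def rep_mem nq_rep)
    have "freq a (rep (s + g)) - freq a (s + g) \<in> \<int>"
      using freq_lat [OF rep_diff, of a "s + g"] by (simp add: freq_diff)
    then have "\<bar>cres (freq a (rep (s + g)))\<bar> = \<bar>cres (freq a (s + g))\<bar>"
      by (rule abs_cres_cong)
    moreover have "\<bar>cres (freq a g)\<bar> \<le> \<bar>cres (freq a (s + g))\<bar> + \<bar>cres (freq a s)\<bar>"
      using abs_cres_triangle [of "freq a (s + g)" "- freq a s"] abs_cres_minus [of "freq a s"]
      by (simp add: freq_add)
    ultimately show ?thesis
      using mem not by (auto simp: bad_def)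
  qed
  then have "nball (2 * r) \<subseteq> bad \<union> {s \<in> nball (2 * r). rep (s + g) \<in> bad}"
    by blast
  moreover have fin2: "finite {s \<in> nball (2 * r). rep (s + g) \<in> bad}"
    by (simp add: finite_nball)
  ultimately have "card (nball (2 * r)) \<le> card (bad \<union> {s \<in> nball (2 * r). rep (s + g) \<in> bad})"
    using fin by (intro card_mono) auto
  also have "\<dots> \<le> card bad + card {s \<in> nball (2 * r). rep (s + g) \<in> bad}"
    by (rule card_Un_le)
  also have "card {s \<in> nball (2 * r). rep (s + g) \<in> bad} \<le> card bad"
  proof (rule card_inj_on_le [OF _ _ fin])
    show "inj_on (\<lambda>s. rep (s + g)) {s \<in> nball (2 * r). rep (s + g) \<in> bad}"
      by (auto simp: inj_on_def nball_def rep_eq_iff reps_eq_iff)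
  qed auto
  finally show False
    using most by (simp add: bad_def)
qed

text \<open>Otherwise every nontrivial character moves many elements of the ball of radius 4r by a
  definite angle. That is a Poincare inequality, which the centred tent at a moderately doubling
  scale W violates, its energy being small of order (r/W)^2.\<close>

lemma exists_low_frequency:
  fixes k j\<^sub>0 :: nat and r :: real
  assumes "r > 0" and "j\<^sub>0 \<ge> 1" and j\<^sub>0: "512 * 8^k \<le> (1 - cos (pi/10)) * 4^j\<^sub>0"
    and growth: "\<And>j. j \<ge> 1 \<Longrightarrow> card (nball (2^j * r)) \<le> (2^j)^k * card (nball (2 * r))"
    and z: "nq z > 2 * (2^((k + 1) * j\<^sub>0 + 1) * r)"
  shows "\<exists>a. (\<exists>x. freq a x \<notin> \<int>) \<and> (\<forall>g. nq g \<le> 2 * r \<longrightarrow> \<bar>cres (freq a g)\<bar> \<le> 1/10)"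
proof (rule ccontr)
  assume no: "\<not> ?thesis"
  obtain j where j: "j\<^sub>0 < j" "j \<le> (k + 1) * j\<^sub>0 + 1"
    "card (nball (2^j * r)) \<le> 2^(k + 1) * card (nball (2^j * r / 2))"
    using doubling_scale [OF \<open>r > 0\<close> \<open>j\<^sub>0 \<ge> 1\<close> growth] by blast
  define W where "W = 2^j * r"
  have "W > 0"
    using \<open>r > 0\<close> by (simp add: W_def)
  define v where "v t = real (card (nball t))" for t
  define \<phi> where "\<phi> x = max 0 (W - nq x)" for x
  define \<mu> where "\<mu> = (\<Sum>x\<in>reps. \<phi> x) / card reps"
  define \<psi> where "\<psi> x = \<phi> x - \<mu>" for x
  define c\<^sub>0 where "c\<^sub>0 = 1 - cos (pi/10)"
  have "c\<^sub>0 > 0"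
    using cos_monotone_0_pi [of 0 "pi/10"] by (simp add: c\<^sub>0_def)
  define hat where "hat a = (\<Sum>x\<in>reps. of_real (\<psi> x) * chr a x)" for a
  have \<psi>_lat: "\<psi> (x + l) = \<psi> x" if "l \<in> lat" for x l
    using nq_lat [OF that] by (simp add: \<psi>_def \<phi>_def)
  have "2 * (2^j * r) \<le> 2 * (2^((k + 1) * j\<^sub>0 + 1) * r)"
    using j(2) \<open>r > 0\<close> by (intro mult_left_mono mult_right_mono power_increasing) auto
  then have big: "2 * card (nball W) \<le> card reps"
    using z by (intro two_disjoint_balls [of W z]) (unfold W_def, linarith)
  have Q: "real (card reps) > 0"
    using finite_reps rep_mem card_gt_0_iff by auto
  have shift: "(\<Sum>x\<in>reps. of_real (\<psi> (x + s) - \<psi> x) * chr a x) = (chr a (- s) - 1) * hat a" for a s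
    unfolding hat_def by (rule Fourier_shift) (rule \<psi>_lat)
  \<comment> \<open>The inequality is proved frequency by frequency; Parseval on both sides then
    turns its sum into a statement about \<psi>.\<close>
  have energy: "c\<^sub>0 * v (2 * r) * (cmod (hat a))\<^sup>2
      \<le> (\<Sum>s\<in>nball (4 * r). (cmod (\<Sum>x\<in>reps. of_real (\<psi> (x + s) - \<psi> x) * chr a x))\<^sup>2)" for a
  proof (cases "\<forall>x. freq a x \<in> \<int>")
    \<comment> \<open>A character trivial on the whole group has no gap, but its coefficient is the
      sum of \<psi>, which centring has made 0.\<close>
    case True
    then have "chr a x = 1" for x
      by (simp add: chr_def)
    then have "hat a = of_real (\<Sum>x\<in>reps. \<psi> x)"
      by (simp add: hat_def)
    also have "(\<Sum>x\<in>reps. \<psi> x) = 0"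
      using Q by (simp add: \<psi>_def sum_subtractf \<mu>_def)
    finally show ?thesis
      by (simp add: sum_nonneg)
  next
    case False
    define bad where "bad = {s \<in> nball (4 * r). \<bar>cres (freq a s)\<bar> > 1/20}"
    have "card (nball (2 * r)) \<le> 2 * card bad"
    proof (rule ccontr)
      assume "\<not> ?thesis"
      then have "2 * card {s \<in> nball (4 * r). \<bar>cres (freq a s)\<bar> > 1/20} < card (nball (2 * r))"
        by (simp add: bad_def)
      then show False
        using no False small_frequency_of_mostly_small [of r a] \<open>r > 0\<close> by auto
    qed
    then have "c\<^sub>0 * v (2 * r) \<le> c\<^sub>0 * (2 * card bad)"
      using \<open>c\<^sub>0 > 0\<close> by (simp add: v_def)
    also have "\<dots> = (\<Sum>s\<in>bad. 2 * c\<^sub>0)"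
      by simp
    also have "\<dots> \<le> (\<Sum>s\<in>bad. (cmod (chr a (- s) - 1))\<^sup>2)"
      unfolding chr_minus_1_norm
      by (intro sum_mono) (use cos_gap in \<open>fastforce simp: bad_def c\<^sub>0_def\<close>)
    also have "\<dots> \<le> (\<Sum>s\<in>nball (4 * r). (cmod (chr a (- s) - 1))\<^sup>2)"
      by (rule sum_mono2 [OF finite_nball]) (auto simp: bad_def)
    finally have "c\<^sub>0 * v (2 * r) * (cmod (hat a))\<^sup>2
        \<le> (\<Sum>s\<in>nball (4 * r). (cmod (chr a (- s) - 1))\<^sup>2) * (cmod (hat a))\<^sup>2"
      by (rule mult_right_mono) simp
    also have "\<dots> = (\<Sum>s\<in>nball (4 * r). (cmod (\<Sum>x\<in>reps. of_real (\<psi> (x + s) - \<psi> x) * chr a x))\<^sup>2)"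
      by (simp only: shift sum_distrib_right norm_mult power_mult_distrib)
    finally show ?thesis .
  qed
  define m where "m = real (M ^ card J)"
  have "m > 0"
    using M_pos by (simp add: m_def)
  have "c\<^sub>0 * v (2 * r) * (m * (\<Sum>x\<in>reps. (\<psi> x)\<^sup>2)) = (\<Sum>a\<in>freqs. c\<^sub>0 * v (2 * r) * (cmod (hat a))\<^sup>2)"
    unfolding m_def hat_def Parseval [symmetric] by (simp add: sum_distrib_left)
  also have "\<dots> \<le> (\<Sum>a\<in>freqs. \<Sum>s\<in>nball (4 * r). (cmod (\<Sum>x\<in>reps. of_real (\<psi> (x + s) - \<psi> x) * chr a x))\<^sup>2)"
    by (intro sum_mono energy)
  also have "\<dots> = (\<Sum>s\<in>nball (4 * r). m * (\<Sum>x\<in>reps. (\<psi> (x + s) - \<psi> x)\<^sup>2))"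
    unfolding m_def Parseval [symmetric] by (rule sum.swap)
  also have "\<dots> \<le> (\<Sum>s\<in>nball (4 * r). m * (2 * (4 * r)\<^sup>2 * v W))"
  proof (intro sum_mono mult_left_mono)
    fix s assume "s \<in> nball (4 * r)"
    then have "nq s \<le> 4 * r"
      by (simp add: nball_def)
    from sum_tent_increment_le [OF this, of W]
    show "(\<Sum>x\<in>reps. (\<psi> (x + s) - \<psi> x)\<^sup>2) \<le> 2 * (4 * r)\<^sup>2 * v W"
      by (simp add: \<psi>_def \<phi>_def v_def)
  qed (use \<open>m > 0\<close> in simp)
  also have "\<dots> = m * (32 * r\<^sup>2 * v (4 * r) * v W)"
    by (simp add: v_def power_mult_distrib)
  finally have "m * (c\<^sub>0 * v (2 * r) * (\<Sum>x\<in>reps. (\<psi> x)\<^sup>2)) \<le> m * (32 * r\<^sup>2 * v (4 * r) * v W)"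
    by (simp add: mult_ac)
  then have upper: "c\<^sub>0 * v (2 * r) * (\<Sum>x\<in>reps. (\<psi> x)\<^sup>2) \<le> 32 * r\<^sup>2 * v (4 * r) * v W"
    using \<open>m > 0\<close> by simp
  \<comment> \<open>The lower bound for the mass: the tent is at least W/2 on the ball of half
    radius, and centring loses a factor 2.\<close>
  have "(W/2)\<^sup>2 * v (W/2) \<le> 2 * (\<Sum>x\<in>reps. (\<psi> x)\<^sup>2)"
    using sum_tent_squares_ge [OF \<open>W > 0\<close>] sum_centred_tent_squares_ge [OF big]
    unfolding v_def \<psi>_def \<phi>_def \<mu>_def by linarith
  then have "c\<^sub>0 * v (2 * r) * ((W/2)\<^sup>2 * v (W/2)) \<le> c\<^sub>0 * v (2 * r) * (2 * (\<Sum>x\<in>reps. (\<psi> x)\<^sup>2))"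
    using \<open>c\<^sub>0 > 0\<close> by (intro mult_left_mono) (auto simp: v_def)
  also have "\<dots> = 2 * (c\<^sub>0 * v (2 * r) * (\<Sum>x\<in>reps. (\<psi> x)\<^sup>2))"
    by simp
  also have "\<dots> \<le> 2 * (32 * r\<^sup>2 * v (4 * r) * v W)"
    using upper by (rule mult_left_mono) simp
  also have "\<dots> \<le> 2 * (32 * r\<^sup>2 * (4^k * v (2 * r)) * (2^(k + 1) * v (W/2)))"
  proof -
    have "v (4 * r) \<le> 4^k * v (2 * r)"
      using growth [of 2] unfolding v_def by (simp flip: of_nat_le_iff [where 'a = real])
    moreover have "v W \<le> 2^(k + 1) * v (W/2)"
      using j(3) unfolding v_def W_def by (simp flip: of_nat_le_iff [where 'a = real])
    ultimately show ?thesis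
      by (intro mult_left_mono mult_mono) (auto simp: v_def)
  qed
  finally have "c\<^sub>0 * v (2 * r) * ((W/2)\<^sup>2 * v (W/2))
      \<le> 2 * (32 * r\<^sup>2 * (4^k * v (2 * r)) * (2^(k + 1) * v (W/2)))" .
  \<comment> \<open>Both sides are brought to the common factor r^2 v(2r) v(W/2) / 4. Cancelling it
    leaves 512 * 4^k * 2^k, the origin of 512 * 8^k, against 4^j with j >
    \<open>j\<^sub>0\<close>.\<close>
  moreover have "c\<^sub>0 * v (2 * r) * ((W/2)\<^sup>2 * v (W/2)) = (c\<^sub>0 * 4^j) * (r\<^sup>2 * v (2 * r) * v (W/2) / 4)"
  proof -
    have "((2::real)^j)\<^sup>2 = 4^j"
      by (simp add: power2_eq_square flip: power_mult_distrib)
    then show ?thesis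
      by (simp add: W_def power_mult_distrib power_divide)
  qed
  moreover have "2 * (32 * r\<^sup>2 * (4^k * v (2 * r)) * (2^(k + 1) * v (W/2)))
      = (512 * (4^k * 2^k)) * (r\<^sup>2 * v (2 * r) * v (W/2) / 4)"
    by simp
  ultimately have "(c\<^sub>0 * 4^j) * (r\<^sup>2 * v (2 * r) * v (W/2) / 4)
      \<le> (512 * (4^k * 2^k)) * (r\<^sup>2 * v (2 * r) * v (W/2) / 4)"
    by (simp only:)
  moreover have "r\<^sup>2 * v (2 * r) * v (W/2) / 4 > 0"
    using nball_pos \<open>r > 0\<close> \<open>W > 0\<close> by (simp add: v_def)
  ultimately have "c\<^sub>0 * 4^j \<le> 512 * (4^k * 2^k)"
    by (rule mult_right_le_imp_le)
  also have "\<dots> \<le> c\<^sub>0 * 4^j\<^sub>0"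
    using j\<^sub>0 by (simp add: c\<^sub>0_def flip: power_mult_distrib)
  also have "\<dots> < c\<^sub>0 * 4^j"
    using \<open>c\<^sub>0 > 0\<close> j(1) by simp
  finally show False
    by simp
qed

end

section \<open>Growth and coarse actions\<close>

locale normed_rational_coordinates = rational_coordinates J c M
  for J :: "'j set" and c :: "'j \<Rightarrow> 'g::ab_group_add \<Rightarrow> real" and M +
  fixes N :: "'g \<Rightarrow> real"
  assumes N_nonneg: "N x \<ge> 0"
    and N_zero: "N 0 = 0"
    and N_minus: "N (- x) = N x"
    and N_add: "N (x + y) \<le> N x + N y"
begin

text \<open>The quotient seminorm. The infimum need not be attained, whence the slack e in its
  properties and the summand 1 in the final bound.\<close>

definition qn :: "'g \<Rightarrow> real" where
  "qn x = (INF l\<in>lat. N (x + l))"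

lemma bdd_below_N: "bdd_below ((\<lambda>l. N (x + l)) ` lat)"
  by (rule bdd_belowI2 [of _ 0]) (simp add: N_nonneg)

lemma qn_le: "l \<in> lat \<Longrightarrow> qn x \<le> N (x + l)"
  unfolding qn_def by (rule cINF_lower [OF bdd_below_N])

lemma qn_le_N: "qn x \<le> N x"
  using qn_le [OF lat_zero, of x] by simp

lemma qn_nonneg: "qn x \<ge> 0"
  unfolding qn_def using lat_zero by (intro cINF_greatest) (auto simp: N_nonneg)

lemma qn_approx:
  assumes "e > 0"
  obtains l where "l \<in> lat" "N (x + l) < qn x + e"
proof -
  have "(INF l\<in>lat. N (x + l)) < qn x + e"
    using assms by (simp add: qn_def)
  then show thesis
    using that lat_zero by (subst (asm) cINF_less_iff [OF _ bdd_below_N]) auto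
qed

sublocale periodic_norm J c M qn
proof
  show "qn (x + l) = qn x" if l: "l \<in> lat" for l x
  proof -
    have le: "qn (x + l) \<le> qn x" if "l \<in> lat" for l x
    proof (rule field_le_epsilon)
      fix e :: real assume "e > 0"
      then obtain l' where l': "l' \<in> lat" "N (x + l') < qn x + e"
        by (rule qn_approx)
      have "qn (x + l) \<le> N ((x + l) + (l' - l))"
        using that l' by (intro qn_le lat_diff)
      then show "qn (x + l) \<le> qn x + e"
        using l' by simp
    qed
    show ?thesis
      using le [OF l, of x] le [OF lat_minus [OF l], of "x + l"] by simp
  qed
  show "qn x \<ge> 0" for x
    by (rule qn_nonneg)
  show "qn 0 = 0"
    using qn_le_N [of 0] qn_nonneg [of 0] by (simp add: N_zero)
  show "qn (- x) = qn x" for x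
  proof -
    have le: "qn (- x) \<le> qn x" for x
    proof (rule field_le_epsilon)
      fix e :: real assume "e > 0"
      then obtain l where l: "l \<in> lat" "N (x + l) < qn x + e"
        by (rule qn_approx)
      have "qn (- x) \<le> N (- x + - l)"
        using l by (intro qn_le lat_minus)
      also have "\<dots> = N (x + l)"
        using N_minus [of "x + l"] by (simp add: add.commute)
      finally show "qn (- x) \<le> qn x + e"
        using l by simp
    qed
    show ?thesis
      using le [of x] le [of "- x"] by simp
  qed
  show "qn (x + y) \<le> qn x + qn y" for x y
  proof (rule field_le_epsilon)
    fix e :: real assume "e > 0"
    then have "e / 2 > 0"
      by simp
    obtain l where l: "l \<in> lat" "N (x + l) < qn x + e / 2"
      by (rule qn_approx [OF \<open>e / 2 > 0\<close>])
    obtain l' where l': "l' \<in> lat" "N (y + l') < qn y + e / 2"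
      by (rule qn_approx [OF \<open>e / 2 > 0\<close>])
    have "qn (x + y) \<le> N ((x + y) + (l + l'))"
      using l l' by (intro qn_le lat_add)
    also have "\<dots> = N ((x + l) + (y + l'))"
      by (simp add: algebra_simps)
    also have "\<dots> \<le> N (x + l) + N (y + l')"
      by (rule N_add)
    finally show "qn (x + y) \<le> qn x + qn y + e"
      using l l' by simp
  qed
qed

lemma N_diff_commute: "N (x - y) = N (y - x)"
  using N_minus [of "x - y"] by simp

text \<open>A separated set of greatest cardinality, which exists because k bounds all of them, is a
  net: a point far from it could be added.\<close>

lemma exists_finite_cover:
  assumes packing: "\<And>S. finite S \<Longrightarrow> (\<And>g. g \<in> S \<Longrightarrow> N g \<le> a) \<Longrightarrow>
      (\<And>g h. g \<in> S \<Longrightarrow> h \<in> S \<Longrightarrow> g \<noteq> h \<Longrightarrow> N (g - h) > b) \<Longrightarrow> card S \<le> k"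
    and "b \<ge> 0"
  obtains F where "finite F" "card F \<le> k" "\<And>g. N g \<le> a \<Longrightarrow> \<exists>f\<in>F. N (g - f) \<le> b"
proof -
  define separated where "separated S \<longleftrightarrow> finite S \<and> (\<forall>g\<in>S. N g \<le> a) \<and>
      (\<forall>g\<in>S. \<forall>h\<in>S. g \<noteq> h \<longrightarrow> N (g - h) > b)" for S
  have bound: "card S \<le> k" if "separated S" for S
    using that by (intro packing) (auto simp: separated_def)
  have "separated {}"
    by (simp add: separated_def)
  then obtain F where F: "separated F" "\<And>S. separated S \<Longrightarrow> card S \<le> card F"
    using ex_has_greatest_nat [of separated "{}" card "Suc k"] bound by (auto simp: less_Suc_eq_le)
  have "\<exists>f\<in>F. N (g - f) \<le> b" if "N g \<le> a" for g
  proof (rule ccontr)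
    assume far: "\<not> ?thesis"
    then have "g \<notin> F"
      using \<open>b \<ge> 0\<close> N_zero by force
    then have "card (insert g F) = Suc (card F)"
      using F(1) by (simp add: separated_def)
    moreover have "N (g - f) > b" "N (f - g) > b" if "f \<in> F" for f
      using far that N_diff_commute [of f g] by (auto simp: not_le)
    then have "separated (insert g F)"
      using F(1) \<open>N g \<le> a\<close> by (simp add: separated_def)
    ultimately show False
      using F(2) [of "insert g F"] by simp
  qed
  then show thesis
    using that [of F] F bound by (auto simp: separated_def)
qed

text \<open>A long element is a sum of steps, and after each step the net F absorbs the remainder
  back into the ball of radius 2r. By commutativity only the multiplicities of the elements of F
  matter, so there are polynomially many sums, with the exponent bounded by k.\<close>

lemma polynomial_growth:
  fixes k m :: nat and r :: real
  assumes "r > 0" and "m \<ge> 1"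
    and chain: "\<And>t g. t \<ge> 0 \<Longrightarrow> N g \<le> t + r \<Longrightarrow> \<exists>h. N h \<le> 2 * r \<and> N (g - h) \<le> t"
    and F: "finite F" "card F \<le> k" "\<And>g. N g \<le> 4 * r \<Longrightarrow> \<exists>f\<in>F. N (g - f) \<le> 2 * r"
  shows "card (nball (m * r)) \<le> m^k * card (nball (2 * r))"
proof -
  \<comment> \<open>\<open>a f\<close> is the multiplicity of f; the inner sum is the
    \<open>a f\<close>-fold multiple of f, as \<open>'g\<close> is merely an abelian group.\<close>
  define comb where "comb a = (\<Sum>f\<in>F. \<Sum>i<(a f::nat). f)" for a
  have comb_upd: "comb (a(f := Suc (a f))) = comb a + f" if "f \<in> F" for a f
    unfolding comb_def using that F(1)
    by (simp add: sum.remove [of F f] add.assoc add.commute)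
  have decompose: "\<exists>a\<in>F \<rightarrow>\<^sub>E {..i}. N (g - comb a) \<le> 2 * r" if "N g \<le> (real i + 2) * r" for i g
    using that
  proof (induction i arbitrary: g)
    case 0
    have "comb (\<lambda>f\<in>F. 0) = 0"
      by (simp add: comb_def)
    then show ?case
      using 0 by (intro bexI [of _ "\<lambda>f\<in>F. 0"]) (simp_all del: restrict_apply)
  next
    case (Suc i)
    have "N g \<le> (real i + 2) * r + r"
      using Suc.prems by (simp add: algebra_simps)
    then obtain h where h: "N h \<le> 2 * r" "N (g - h) \<le> (real i + 2) * r"
      using chain [of "(real i + 2) * r" g] \<open>r > 0\<close> by auto
    then obtain a where a: "a \<in> F \<rightarrow>\<^sub>E {..i}" "N (g - h - comb a) \<le> 2 * r"
      using Suc.IH by blast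
    \<comment> \<open>The old remainder and the step h contribute 2r each, which is why F must cover
      the ball of radius 4r.\<close>
    have "N (g - comb a) \<le> 4 * r"
      using N_add [of "g - h - comb a" h] a h by (simp add: algebra_simps)
    then obtain f where f: "f \<in> F" "N (g - comb a - f) \<le> 2 * r"
      using F(3) by blast
    have "a(f := Suc (a f)) \<in> F \<rightarrow>\<^sub>E {..Suc i}"
      using a(1) f(1) by (auto simp: PiE_iff extensional_def intro: le_SucI)
    then show ?case
      using f comb_upd [of f a]
      by (intro bexI [of _ "a(f := Suc (a f))"]) (simp_all add: diff_diff_eq del: fun_upd_apply)
  qed
  let ?B = "(F \<rightarrow>\<^sub>E {..m - 1}) \<times> nball (2 * r)"
  have "nball (m * r) \<subseteq> (\<lambda>(a, y). rep (y + comb a)) ` ?B"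
  proof
    fix x assume x: "x \<in> nball (m * r)"
    obtain l where l: "l \<in> lat" "N (x + l) < qn x + r"
      using qn_approx [OF \<open>r > 0\<close>] by blast
    \<comment> \<open>The slack r in approximating the infimum gives (m + 1) r = ((m - 1) + 2) r, so
      multiplicities run up to m - 1 and each has exactly m values.\<close>
    then have "N (x + l) \<le> (real (m - 1) + 2) * r"
      using x \<open>m \<ge> 1\<close> by (simp add: nball_def algebra_simps of_nat_diff)
    then obtain a where a: "a \<in> F \<rightarrow>\<^sub>E {..m - 1}" "N (x + l - comb a) \<le> 2 * r"
      using decompose by blast
    define y where "y = rep (x + l - comb a)"
    have "y \<in> nball (2 * r)"
      using qn_le_N [of "x + l - comb a"] a by (simp add: y_def nball_def rep_mem nq_rep)
    moreover have "rep (y + comb a) = rep x"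
      using lat_add [OF rep_diff [of "x + l - comb a"] l(1)] by (simp add: rep_eq_iff y_def algebra_simps)
    ultimately show "x \<in> (\<lambda>(a, y). rep (y + comb a)) ` ?B"
      using x a(1) by (force simp: nball_def rep_reps)
  qed
  moreover have "finite ?B"
    by (simp add: F(1) finite_PiE finite_nball)
  ultimately have "card (nball (m * r)) \<le> card ?B"
    by (meson card_image_le card_mono finite_imageI order_trans)
  also have "\<dots> = m ^ card F * card (nball (2 * r))"
    using F(1) \<open>m \<ge> 1\<close> by (simp add: card_cartesian_product card_PiE)
  also have "\<dots> \<le> m ^ k * card (nball (2 * r))"
    using F(2) \<open>m \<ge> 1\<close> by (intro mult_right_mono power_increasing) auto
  finally show ?thesis .
qed

end

section \<open>Coarse geometry of an orbit, and the lifting of circle-valued homomorphisms to real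
  ones\<close>

locale coarse_abelian_action =
  fixes X :: "'a metric" and \<rho> :: "'g::ab_group_add \<Rightarrow> 'a \<Rightarrow> 'a" and p :: 'a and D :: real
  assumes D_pos: "D > 0"
    and p_mem: "p \<in> mspace X"
    and act_mem: "x \<in> mspace X \<Longrightarrow> \<rho> g x \<in> mspace X"
    and act_dist: "x \<in> mspace X \<Longrightarrow> y \<in> mspace X \<Longrightarrow> mdist X (\<rho> g x) (\<rho> g y) = mdist X x y"
    and act_add: "x \<in> mspace X \<Longrightarrow> \<rho> (g + h) x = \<rho> g (\<rho> h x)"
    and act_zero: "x \<in> mspace X \<Longrightarrow> \<rho> 0 x = x"
    and dense: "x \<in> mspace X \<Longrightarrow> \<exists>g. mdist X x (\<rho> g p) \<le> 2 * D"
    and geodesic: "geodesic_metric X"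
begin

definition N :: "'g \<Rightarrow> real" where
  "N g = mdist X (\<rho> g p) p"

lemma N_diff: "N (g - h) = mdist X (\<rho> g p) (\<rho> h p)"
proof -
  have "mdist X (\<rho> (h + (g - h)) p) (\<rho> h p) = mdist X (\<rho> h (\<rho> (g - h) p)) (\<rho> h p)"
    by (simp only: act_add p_mem)
  then show ?thesis
    by (simp add: N_def act_dist act_mem p_mem)
qed

lemma N_nonneg: "N g \<ge> 0"
  by (simp add: N_def)

lemma N_zero: "N 0 = 0"
  by (simp add: N_def act_zero p_mem)

lemma N_minus: "N (- g) = N g"
  using N_diff [of 0 g] by (simp add: N_def act_zero p_mem mdist_commute)

lemma N_add: "N (g + h) \<le> N g + N h"
proof -
  have "mdist X (\<rho> (g + h) p) p \<le> mdist X (\<rho> (g + h) p) (\<rho> g p) + mdist X (\<rho> g p) p"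
    by (intro mdist_triangle act_mem p_mem)
  moreover have "N (g + h - g) = mdist X (\<rho> (g + h) p) (\<rho> g p)"
    by (rule N_diff)
  ultimately show ?thesis
    by (simp add: N_def)
qed

text \<open>For long g take the geodesic point 6D away from p and an orbit point h p within 2D of
  it: h has norm at most 6D + 2D, and the rest shrinks by 6D - 2D. This is the step condition for
  growth with r = 4D.\<close>

lemma chain:
  assumes "t \<ge> 0" and "N g \<le> t + 4 * D"
  shows "\<exists>h. N h \<le> 8 * D \<and> N (g - h) \<le> t"
proof (cases "N g \<le> 8 * D")
  case True
  then show ?thesis
    using assms by (intro exI [of _ g]) (simp add: N_zero)
next
  case False
  define d where "d = mdist X p (\<rho> g p)"
  have Nd: "N g = d"
    by (simp add: N_def d_def mdist_commute)
  obtain \<gamma> where \<gamma>: "\<gamma> \<in> {0..d} \<rightarrow> mspace X" "\<gamma> 0 = p" "\<gamma> d = \<rho> g p"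
    "\<And>s t. s \<in> {0..d} \<Longrightarrow> t \<in> {0..d} \<Longrightarrow> mdist X (\<gamma> s) (\<gamma> t) = \<bar>s - t\<bar>"
    using geodesic p_mem act_mem [OF p_mem] unfolding geodesic_metric_def d_def by meson
  define s where "s = 6 * D"
  have s: "s \<in> {0..d}" "0 \<in> {0..d}" "d \<in> {0..d}"
    using False D_pos by (auto simp: s_def Nd)
  have zX: "\<gamma> s \<in> mspace X"
    using \<gamma>(1) s by blast
  obtain h where h: "mdist X (\<gamma> s) (\<rho> h p) \<le> 2 * D"
    using dense [OF zX] by blast
  have "N h \<le> mdist X (\<rho> h p) (\<gamma> s) + mdist X (\<gamma> s) p"
    unfolding N_def by (intro mdist_triangle act_mem p_mem zX)
  also have "mdist X (\<gamma> s) p = s"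
    using \<gamma>(4) [OF s(1,2)] s by (simp add: \<gamma>(2))
  finally have "N h \<le> 8 * D"
    using h by (simp add: mdist_commute s_def)
  have "N (g - h) \<le> mdist X (\<rho> g p) (\<gamma> s) + mdist X (\<gamma> s) (\<rho> h p)"
    unfolding N_diff by (intro mdist_triangle act_mem p_mem zX)
  also have "mdist X (\<rho> g p) (\<gamma> s) = d - s"
    using \<gamma>(4) [OF s(3,1)] s by (simp add: \<gamma>(3))
  finally have "N (g - h) \<le> t"
    using h assms by (simp add: s_def Nd)
  then show ?thesis
    using \<open>N h \<le> 8 * D\<close> by blast
qed

lemma locally_constant_imp_constant:
  assumes "\<epsilon> > 0" and "x \<in> mspace X" "y \<in> mspace X"
    and f: "\<And>x y. x \<in> mspace X \<Longrightarrow> y \<in> mspace X \<Longrightarrow> mdist X x y < \<epsilon> \<Longrightarrow> f x = f y"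
  shows "f x = f y"
proof -
  define d where "d = mdist X x y"
  obtain \<gamma> where \<gamma>: "\<gamma> \<in> {0..d} \<rightarrow> mspace X" "\<gamma> 0 = x" "\<gamma> d = y"
    "\<And>s t. s \<in> {0..d} \<Longrightarrow> t \<in> {0..d} \<Longrightarrow> mdist X (\<gamma> s) (\<gamma> t) = \<bar>s - t\<bar>"
    using geodesic assms(2,3) unfolding geodesic_metric_def d_def by meson
  have "f (\<gamma> 0) = f (\<gamma> d)"
  proof (rule locally_constant_on_interval [where f = "\<lambda>t. f (\<gamma> t)"])
    show "f (\<gamma> s) = f (\<gamma> t)" if "s \<in> {0..d}" "t \<in> {0..d}" "\<bar>s - t\<bar> < \<epsilon>" for s t
      using \<gamma>(1) \<gamma>(4) [OF that(1,2)] that by (intro f) auto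
  qed (use assms in \<open>simp_all add: d_def\<close>)
  then show ?thesis
    by (simp add: \<gamma>)
qed

text \<open>Evaluate \<theta> at chosen orbit points and lift the result to H. The change of H under
  g, corrected by a small error, is congruent to \<theta> g and independent of the point, which
  makes it a homomorphism in g.\<close>

lemma lift_circle_homomorphism:
  fixes \<theta> :: "'g \<Rightarrow> real"
  assumes sc: "simply_connected_space (mtopology_of X)"
    and \<theta>_add: "\<And>g h. \<theta> (g + h) = \<theta> g + \<theta> h"
    and \<theta>_small: "\<And>g. N g \<le> 8 * D \<Longrightarrow> \<bar>cres (\<theta> g)\<bar> \<le> 1/10"
  obtains \<Lambda> where "\<And>g h. \<Lambda> (g + h) = \<Lambda> g + \<Lambda> h" and "\<And>g. \<Lambda> g - \<theta> g \<in> \<int>"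
    and "\<And>g. N g \<le> 2 * D \<Longrightarrow> \<theta> g \<in> \<int> \<Longrightarrow> \<Lambda> g = 0"
proof -
  have \<theta>_diff: "\<theta> (g - h) = \<theta> g - \<theta> h" for g h
    using \<theta>_add [of "g - h" h] by simp
  obtain b where b: "\<And>x. x \<in> mspace X \<Longrightarrow> mdist X x (\<rho> (b x) p) \<le> 2 * D"
    using dense by metis
  define u where "u x = \<theta> (b x)" for x
  \<comment> \<open>The norm of g - h is at most 2D + 4D + 2D, the radius on which \<theta> is
    assumed small. No choice of orbit points is fixed here, so this also compares different choices
    for one point.\<close>
  have u_near: "\<bar>cres (\<theta> g - \<theta> h)\<bar> \<le> 1/10"
    if "x \<in> mspace X" "y \<in> mspace X" "mdist X x (\<rho> g p) \<le> 2 * D" "mdist X y (\<rho> h p) \<le> 2 * D"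
      "mdist X x y \<le> 4 * D" for x y g h
  proof -
    have "N (g - h) \<le> mdist X (\<rho> g p) x + mdist X x (\<rho> h p)"
      unfolding N_diff by (intro mdist_triangle act_mem p_mem that)
    also have "mdist X x (\<rho> h p) \<le> mdist X x y + mdist X y (\<rho> h p)"
      by (intro mdist_triangle act_mem p_mem that)
    finally have "N (g - h) \<le> 8 * D"
      using that by (simp add: mdist_commute)
    from \<theta>_small [OF this] show ?thesis
      by (simp add: \<theta>_diff)
  qed
  have "\<bar>cres (u x - u y)\<bar> \<le> 1/10" if "x \<in> mspace X" "y \<in> mspace X" "mdist X x y < 3 * D" for x y
    unfolding u_def using that D_pos by (intro u_near [of x y] b) auto
  moreover have "3 * D > 0"
    using D_pos by simp
  ultimately obtain H where H: "\<And>x. x \<in> mspace X \<Longrightarrow> H x - u x \<in> \<int>"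
    "\<And>x y. x \<in> mspace X \<Longrightarrow> y \<in> mspace X \<Longrightarrow> mdist X x y < 3 * D \<Longrightarrow> \<bar>H x - H y\<bar> \<le> 1/10"
    using coarse_lift_simply_connected [of "3 * D" X u] sc geodesic by metis
  \<comment> \<open>The failure of the choice b to be equivariant: both b(g x) and g + b(x) are
    admissible for the point g x.\<close>
  define e where "e g x = cres (u (\<rho> g x) - (\<theta> g + u x))" for g x
  have e_le: "\<bar>e g x\<bar> \<le> 1/10" if x: "x \<in> mspace X" for g x
    unfolding e_def u_def \<theta>_add [symmetric]
  proof (rule u_near)
    show "mdist X (\<rho> g x) (\<rho> (g + b x) p) \<le> 2 * D"
      using b [OF x] by (simp add: act_add act_dist act_mem p_mem x)
    show "mdist X (\<rho> g x) (\<rho> g x) \<le> 4 * D"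
      using D_pos by (simp add: mdist_self act_mem x)
  qed (use act_mem x b in auto)
  define K where "K g x = H (\<rho> g x) - H x - e g x" for g x
  have K_Ints: "K g x - \<theta> g \<in> \<int>" if x: "x \<in> mspace X" for g x
  proof -
    have "(H (\<rho> g x) - u (\<rho> g x)) - (H x - u x) + ((u (\<rho> g x) - (\<theta> g + u x)) - e g x) \<in> \<int>"
      unfolding e_def by (intro Ints_add Ints_diff H act_mem x cres_diff_Ints)
    then show ?thesis
      by (simp add: K_def algebra_simps)
  qed
  \<comment> \<open>Two increments of H and two errors e change K by at most 4/10, while it stays in
    one class modulo 1; so K is locally constant, and geodesics make it constant.\<close>
  have K_const: "K g x = K g p" if x: "x \<in> mspace X" for g x
  proof (rule locally_constant_imp_constant [OF \<open>3 * D > 0\<close> x p_mem])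
    fix x y assume xy: "x \<in> mspace X" "y \<in> mspace X" "mdist X x y < 3 * D"
    have "\<bar>H x - H y\<bar> \<le> 1/10" "\<bar>H (\<rho> g x) - H (\<rho> g y)\<bar> \<le> 1/10"
      using xy by (intro H(2); simp add: act_mem act_dist)+
    then have "\<bar>K g x - K g y\<bar> < 1"
      using e_le [OF xy(1), of g] e_le [OF xy(2), of g] unfolding K_def by linarith
    moreover have "K g x - K g y \<in> \<int>"
      using Ints_diff [OF K_Ints [OF xy(1), of g] K_Ints [OF xy(2), of g]] by simp
    ultimately show "K g x = K g y"
      using Ints_abs_less_1 by fastforce
  qed
  show thesis
  proof (rule that [of "\<lambda>g. K g p"])
    show "K g p - \<theta> g \<in> \<int>" for g
      by (rule K_Ints [OF p_mem])
    show "K (g + h) p = K g p + K h p" for g h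
    proof -
      have hp: "\<rho> h p \<in> mspace X"
        by (simp add: act_mem p_mem)
      have "K (g + h) p - (K g (\<rho> h p) + K h p) = e g (\<rho> h p) + e h p - e (g + h) p"
        by (simp add: K_def act_add p_mem)
      then have "\<bar>K (g + h) p - (K g p + K h p)\<bar> < 1"
        using e_le [OF hp, of g] e_le [OF p_mem, of h] e_le [OF p_mem, of "g + h"]
        unfolding K_const [OF hp] by linarith
      moreover have "K (g + h) p - (K g p + K h p) \<in> \<int>"
        using Ints_diff [OF K_Ints [OF p_mem, of "g + h"]
            Ints_add [OF K_Ints [OF p_mem, of g] K_Ints [OF p_mem, of h]]]
        by (simp add: \<theta>_add algebra_simps)
      ultimately show ?thesis
        using Ints_abs_less_1 by fastforce
    qed
    \<comment> \<open>Here the lift needs a scale above 2D; 3D lies between this and the 4D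
      permitted by \<open>u_near\<close>.\<close>
    show "K g p = 0" if "N g \<le> 2 * D" "\<theta> g \<in> \<int>" for g
    proof (rule Ints_abs_less_1)
      show "K g p \<in> \<int>"
        using Ints_add [OF K_Ints [OF p_mem, of g] that(2)] by simp
      have "\<bar>H (\<rho> g p) - H p\<bar> \<le> 1/10"
        using that D_pos by (intro H(2) act_mem p_mem) (simp_all add: N_def)
      then show "\<bar>K g p\<bar> < 1"
        using e_le [OF p_mem, of g] unfolding K_def by linarith
    qed
  qed
qed

end

locale coordinatized_action = coarse_abelian_action X \<rho> p D + rational_coordinates J c M
  for X :: "'a metric" and \<rho> :: "'g::ab_group_add \<Rightarrow> 'a \<Rightarrow> 'a" and p D
    and J :: "'j set" and c :: "'j \<Rightarrow> 'g \<Rightarrow> real" and M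
begin

sublocale normed_rational_coordinates J c M N
  by unfold_locales (simp_all add: N_nonneg N_zero N_minus N_add)

text \<open>\<open>rigid\<close> is the algebraic input: a real homomorphism is determined by its
  values on short lattice elements. It forces the lift of a low character to be 0, hence the
  character to be trivial, against its choice. The bound is 2 * 2^j * r with r = 4D and j the last
  scale searched, plus 1 for the infimum.\<close>

lemma lattice_codiameter:
  fixes k j\<^sub>0 :: nat
  assumes sc: "simply_connected_space (mtopology_of X)"
    and packing: "\<And>S. finite S \<Longrightarrow> (\<And>g. g \<in> S \<Longrightarrow> N g \<le> 16 * D) \<Longrightarrow>
      (\<And>g h. g \<in> S \<Longrightarrow> h \<in> S \<Longrightarrow> g \<noteq> h \<Longrightarrow> N (g - h) > 8 * D) \<Longrightarrow> card S \<le> k"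
    and "j\<^sub>0 \<ge> 1" and j\<^sub>0: "512 * 8^k \<le> (1 - cos (pi/10)) * 4^j\<^sub>0"
    and rigid: "\<And>\<Lambda> g. (\<And>g h. \<Lambda> (g + h) = \<Lambda> g + \<Lambda> h) \<Longrightarrow>
      (\<And>g. g \<in> lat \<Longrightarrow> N g \<le> 2 * D \<Longrightarrow> \<Lambda> g = 0) \<Longrightarrow> \<Lambda> g = (0::real)"
  shows "\<exists>l\<in>lat. N (g + l) \<le> 8 * D * 2^((k + 1) * j\<^sub>0 + 1) + 1"
proof -
  let ?r = "4 * D"
  have "?r > 0"
    using D_pos by simp
  obtain F where F: "finite F" "card F \<le> k" "\<And>g. N g \<le> 4 * ?r \<Longrightarrow> \<exists>f\<in>F. N (g - f) \<le> 2 * ?r"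
    by (rule exists_finite_cover [of "4 * ?r" "2 * ?r" k]) (use packing D_pos in auto)
  have growth: "card (nball (2^j * ?r)) \<le> (2^j)^k * card (nball (2 * ?r))" for j
    using polynomial_growth [OF \<open>?r > 0\<close> _ _ F, of "2^j"] chain by simp
  have "qn g \<le> 2 * (2^((k + 1) * j\<^sub>0 + 1) * ?r)"
  proof (rule ccontr)
    assume "\<not> ?thesis"
    then have big: "qn g > 2 * (2^((k + 1) * j\<^sub>0 + 1) * ?r)"
      by simp
    obtain a where a: "\<exists>x. freq a x \<notin> \<int>" "\<forall>g. qn g \<le> 2 * ?r \<longrightarrow> \<bar>cres (freq a g)\<bar> \<le> 1/10"
      using exists_low_frequency [OF \<open>?r > 0\<close> \<open>j\<^sub>0 \<ge> 1\<close> j\<^sub>0 growth big] by blast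
    have small: "\<bar>cres (freq a g)\<bar> \<le> 1/10" if "N g \<le> 8 * D" for g
      using qn_le_N [of g] that a(2) by auto
    have "freq a x \<in> \<int>" for x
    proof (rule lift_circle_homomorphism [OF sc freq_add small])
      fix \<Lambda> assume \<Lambda>: "\<And>g h. \<Lambda> (g + h) = \<Lambda> g + \<Lambda> h" "\<And>g. \<Lambda> g - freq a g \<in> \<int>"
        "\<And>g. N g \<le> 2 * D \<Longrightarrow> freq a g \<in> \<int> \<Longrightarrow> \<Lambda> g = 0"
      have "\<Lambda> x = 0"
        by (rule rigid) (auto simp: \<Lambda>(1) intro: \<Lambda>(3) freq_lat)
      then show "freq a x \<in> \<int>"
        using \<Lambda>(2) [of x] by (simp add: minus_in_Ints_iff)
    qed
    then show False
      using a(1) by blast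
  qed
  moreover obtain l where "l \<in> lat" "N (g + l) < qn g + 1"
    using qn_approx [of 1 g] by auto
  ultimately show ?thesis
    by (intro bexI [of _ l]) (auto simp: mult_ac)
qed

end

section \<open>Sublattices of full rank\<close>

text \<open>Elimination without fractions: cross-multiplying with a pivot vector kills the
  coordinate k and leaves one vector fewer, so both cardinalities drop by one.\<close>

lemma integer_relation_exists:
  fixes u :: "'i \<Rightarrow> 'k \<Rightarrow> int"
  assumes "finite K" "finite I" "card I > card K"
  shows "\<exists>a. (\<exists>i\<in>I. a i \<noteq> 0) \<and> (\<forall>k\<in>K. (\<Sum>i\<in>I. a i * u i k) = 0)"
  using assms
proof (induction K arbitrary: I u rule: finite_induct)
  case empty
  then obtain i where "i \<in> I"
    by fastforce
  then show ?case
    by (intro exI [of _ "\<lambda>_. 1"]) auto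
next
  case (insert k K)
  show ?case
  proof (cases "\<exists>i\<in>I. u i k \<noteq> 0")
    case False
    moreover obtain a where "\<exists>i\<in>I. a i \<noteq> 0" "\<forall>k\<in>K. (\<Sum>i\<in>I. a i * u i k) = 0"
      using insert.IH [of I u] insert.prems insert.hyps by auto
    ultimately show ?thesis
      by (intro exI [of _ a]) auto
  next
    case True
    then obtain i\<^sub>0 where o: "i\<^sub>0 \<in> I" "u i\<^sub>0 k \<noteq> 0"
      by blast
    let ?I = "I - {i\<^sub>0}"
    obtain a where a: "\<exists>i\<in>?I. a i \<noteq> 0"
      "\<forall>l\<in>K. (\<Sum>i\<in>?I. a i * (u i\<^sub>0 k * u i l - u i k * u i\<^sub>0 l)) = 0"
      using insert.IH [of ?I "\<lambda>i l. u i\<^sub>0 k * u i l - u i k * u i\<^sub>0 l"] insert.prems insert.hyps o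
      by (auto simp: less_diff_conv)
    \<comment> \<open>The elimination is undone: the pivot receives the coefficient that collects
      all multiples of it subtracted before.\<close>
    define b where "b = (\<lambda>i. u i\<^sub>0 k * a i)(i\<^sub>0 := - (\<Sum>i\<in>?I. a i * u i k))"
    have b: "(\<Sum>i\<in>I. b i * u i l) = (\<Sum>i\<in>?I. a i * (u i\<^sub>0 k * u i l - u i k * u i\<^sub>0 l))" for l
    proof -
      have "(\<Sum>i\<in>I. b i * u i l) = b i\<^sub>0 * u i\<^sub>0 l + (\<Sum>i\<in>?I. b i * u i l)"
        using insert.prems o by (simp add: sum.remove)
      also have "(\<Sum>i\<in>?I. b i * u i l) = (\<Sum>i\<in>?I. u i\<^sub>0 k * a i * u i l)"
        by (intro sum.cong) (auto simp: b_def)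
      also have "b i\<^sub>0 * u i\<^sub>0 l = - (\<Sum>i\<in>?I. a i * u i k * u i\<^sub>0 l)"
        by (simp add: b_def sum_distrib_right)
      finally show ?thesis
        by (simp add: right_diff_distrib sum_subtractf mult_ac)
    qed
    show ?thesis
    proof (intro exI conjI ballI)
      show "\<exists>i\<in>I. b i \<noteq> 0"
        using a(1) o by (auto simp: b_def)
      fix l assume "l \<in> insert k K"
      then show "(\<Sum>i\<in>I. b i * u i l) = 0"
        using a(2) unfolding b by auto
    qed
  qed
qed

text \<open>Adding v, indexed by \<open>None\<close>, to a full independent family forces a
  relation. Independence makes the coefficient of v nonzero, and its absolute value is the
  denominator.\<close>

lemma full_rank_denominator:
  fixes w :: "'j \<Rightarrow> 'j \<Rightarrow> int"
  assumes J: "finite J"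
    and indep: "\<And>a. (\<And>k. k \<in> J \<Longrightarrow> (\<Sum>j\<in>J. a j * w j k) = 0) \<Longrightarrow> \<forall>j\<in>J. a j = 0"
  shows "\<exists>m b. m > (0::nat) \<and> (\<forall>k\<in>J. int m * v k = (\<Sum>j\<in>J. b j * w j k))"
proof -
  define u where "u i k = (case i of None \<Rightarrow> v k | Some j \<Rightarrow> w j k)" for i k
  let ?I = "insert None (Some ` J)"
  have "card ?I > card J"
    using J by (simp add: card_image)
  then obtain a where a: "\<exists>i\<in>?I. a i \<noteq> 0" "\<forall>k\<in>J. (\<Sum>i\<in>?I. a i * u i k) = 0"
    using integer_relation_exists [of J ?I u] J by auto
  have split: "(\<Sum>i\<in>?I. a i * u i k) = a None * v k + (\<Sum>j\<in>J. a (Some j) * w j k)" for k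
    using J by (simp add: u_def sum.reindex image_iff)
  have "a None \<noteq> 0"
  proof
    assume "a None = 0"
    moreover have "\<forall>j\<in>J. a (Some j) = 0"
      using a(2) split \<open>a None = 0\<close> by (intro indep) auto
    ultimately show False
      using a(1) by auto
  qed
  have rel: "a None * v k = (\<Sum>j\<in>J. - a (Some j) * w j k)" if "k \<in> J" for k
    using a(2) that unfolding split by (simp add: sum_negf eq_neg_iff_add_eq_0)
  show ?thesis
  proof (intro exI conjI ballI)
    show "nat \<bar>a None\<bar> > 0"
      using \<open>a None \<noteq> 0\<close> by simp
    fix k assume k: "k \<in> J"
    have "int (nat \<bar>a None\<bar>) * v k = sgn (a None) * (a None * v k)"
      by (simp add: sgn_if)
    also have "\<dots> = (\<Sum>j\<in>J. (sgn (a None) * - a (Some j)) * w j k)"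
      unfolding rel [OF k] sum_distrib_left mult.assoc ..
    finally show "int (nat \<bar>a None\<bar>) * v k = (\<Sum>j\<in>J. (sgn (a None) * - a (Some j)) * w j k)" .
  qed
qed

text \<open>B is \<open>M\<close> times the inverse of the matrix w, built from denominators of the
  unit vectors with their product as common multiple.\<close>

lemma exists_rational_coordinates:
  fixes w :: "'j \<Rightarrow> 'j \<Rightarrow> int"
  assumes J: "finite J"
    and indep: "\<And>a. (\<And>k. k \<in> J \<Longrightarrow> (\<Sum>j\<in>J. a j * w j k) = 0) \<Longrightarrow> \<forall>j\<in>J. a j = 0"
  shows "\<exists>M (B :: 'j \<Rightarrow> 'j \<Rightarrow> int). M > (0::nat) \<and>
    (\<forall>v. \<forall>k\<in>J. int M * v k = (\<Sum>j\<in>J. (\<Sum>i\<in>J. v i * B i j) * w j k)) \<and>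
    (\<forall>i\<in>J. \<forall>j\<in>J. (\<Sum>l\<in>J. w i l * B l j) = (if i = j then int M else 0))"
proof -
  define e where "e i k = (if k = i then 1 else 0 :: int)" for i k :: 'j
  have "\<forall>i. \<exists>m b. m > (0::nat) \<and> (\<forall>k\<in>J. int m * e i k = (\<Sum>j\<in>J. b j * w j k))"
    using full_rank_denominator [OF J indep] by blast
  then obtain m b where mb: "\<And>i. m i > (0::nat)"
    "\<And>i k. k \<in> J \<Longrightarrow> int (m i) * e i k = (\<Sum>j\<in>J. b i j * w j k)"
    by metis
  define M where "M = (\<Prod>i\<in>J. m i)"
  define B where "B i j = int (M div m i) * b i j" for i j
  have M: "M > 0"
    using mb(1) by (simp add: M_def prod_pos)
  have row: "int M * e i k = (\<Sum>j\<in>J. B i j * w j k)" if "i \<in> J" "k \<in> J" for i k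
  proof -
    have "m i dvd M"
      unfolding M_def using J that by (simp add: dvd_prodI)
    then have "int M = int (M div m i) * int (m i)"
      by (simp flip: of_nat_mult)
    then have "int M * e i k = int (M div m i) * (int (m i) * e i k)"
      by simp
    also have "\<dots> = (\<Sum>j\<in>J. B i j * w j k)"
      unfolding mb(2) [OF that(2)] B_def sum_distrib_left mult.assoc ..
    finally show ?thesis .
  qed
  have expand: "int M * v k = (\<Sum>j\<in>J. (\<Sum>i\<in>J. v i * B i j) * w j k)" if "k \<in> J" for v k
  proof -
    have "(\<Sum>j\<in>J. (\<Sum>i\<in>J. v i * B i j) * w j k) = (\<Sum>i\<in>J. v i * (\<Sum>j\<in>J. B i j * w j k))"
      unfolding sum_distrib_right sum_distrib_left by (subst sum.swap) (simp add: mult_ac)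
    also have "\<dots> = (\<Sum>i\<in>J. v i * (int M * e i k))"
      using row that by simp
    also have "\<dots> = (\<Sum>i\<in>J. if i = k then int M * v k else 0)"
      by (intro sum.cong) (auto simp: e_def)
    also have "\<dots> = int M * v k"
      using J that by simp
    finally show ?thesis ..
  qed
  have "(\<Sum>l\<in>J. w i l * B l j) = (if i = j then int M else 0)" if ij: "i \<in> J" "j \<in> J" for i j
  proof -
    \<comment> \<open>A left inverse is a right inverse: w B and \<open>M\<close> times the identity
      agree after multiplication by w, whose rows are independent.\<close>
    have "\<forall>j\<in>J. (\<Sum>l\<in>J. w i l * B l j) - (if j = i then int M else 0) = 0"
    proof (rule indep)
      fix k assume k: "k \<in> J"
      have "(\<Sum>j\<in>J. (if j = i then int M else 0) * w j k) = (\<Sum>j\<in>J. if j = i then int M * w i k else 0)"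
        by (intro sum.cong) auto
      also have "\<dots> = int M * w i k"
        using J ij by simp
      finally show "(\<Sum>j\<in>J. ((\<Sum>l\<in>J. w i l * B l j) - (if j = i then int M else 0)) * w j k) = 0"
        using expand [OF k, of "w i"] by (simp add: left_diff_distrib sum_subtractf)
    qed
    then show ?thesis
      using ij by auto
  qed
  then show ?thesis
    using M expand by blast
qed

lemma additive_zero:
  fixes f :: "'g::ab_group_add \<Rightarrow> 'h::ab_group_add"
  assumes "\<And>a b. f (a + b) = f a + f b"
  shows "f 0 = 0"
  using assms [of 0 0] by simp

lemma additive_minus:
  fixes f :: "'g::ab_group_add \<Rightarrow> 'h::ab_group_add"
  assumes "\<And>a b. f (a + b) = f a + f b"
  shows "f (- a) = - f a"
  using assms [of a "- a"] additive_zero [of f, OF assms] by (simp add: eq_neg_iff_add_eq_0 add.commute)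

lemma additive_scale:
  fixes f :: "('j \<Rightarrow> int) \<Rightarrow> 'h::comm_ring_1"
  assumes f: "\<And>a b. f (a + b) = f a + f b"
  shows "f (\<lambda>k. m * v k) = of_int m * f v"
proof -
  have nat: "f (\<lambda>k. int n * v k) = of_nat n * f v" for n
  proof (induction n)
    case 0
    have "(\<lambda>k. int 0 * v k) = 0"
      by (simp add: fun_eq_iff)
    then show ?case
      using additive_zero [of f, OF f] by simp
  next
    case (Suc n)
    have "(\<lambda>k. int (Suc n) * v k) = (\<lambda>k. int n * v k) + v"
      by (simp add: fun_eq_iff algebra_simps)
    then show ?case
      using Suc by (simp add: f algebra_simps)
  qed
  show ?thesis
  proof (cases "m \<ge> 0")
    case True
    then show ?thesis
      using nat [of "nat m"] by simp
  next
    case False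
    have "(\<lambda>k. m * v k) = - (\<lambda>k. int (nat (- m)) * v k)"
      using False by (simp add: fun_eq_iff)
    then have "f (\<lambda>k. m * v k) = - f (\<lambda>k. int (nat (- m)) * v k)"
      by (simp only: additive_minus [of f, OF f])
    then show ?thesis
      using False by (simp only: nat) simp
  qed
qed

lemma additive_lincomb:
  fixes f :: "('j \<Rightarrow> int) \<Rightarrow> 'h::comm_ring_1"
  assumes f: "\<And>a b. f (a + b) = f a + f b" and "finite I"
  shows "f (\<lambda>k. \<Sum>i\<in>I. a i * w i k) = (\<Sum>i\<in>I. of_int (a i) * f (w i))"
  using \<open>finite I\<close>
proof (induction I rule: finite_induct)
  case empty
  have "(\<lambda>k. \<Sum>i\<in>{}. a i * w i k) = 0"
    by (simp add: fun_eq_iff)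
  then show ?case
    using additive_zero [of f, OF f] by simp
next
  case (insert i I)
  have "(\<lambda>k. \<Sum>i\<in>insert i I. a i * w i k) = (\<lambda>k. a i * w i k) + (\<lambda>k. \<Sum>i\<in>I. a i * w i k)"
    using insert.hyps by (simp add: fun_eq_iff)
  then show ?case
    using insert by (simp add: f additive_scale [of f, OF f])
qed

section \<open>Packing and orbit spaces\<close>

definition packing_bound :: "'a metric \<Rightarrow> 'a \<Rightarrow> real \<Rightarrow> real \<Rightarrow> nat \<Rightarrow> bool" where
  "packing_bound X x R s k \<longleftrightarrow>
     (\<forall>S. finite S \<and> S \<subseteq> mball_of X x R \<and> (\<forall>y\<in>S. \<forall>z\<in>S. y \<noteq> z \<longrightarrow> mdist X y z > s) \<longrightarrow> card S \<le> k)"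

lemma packing_bound_mono: "packing_bound X x R s k \<Longrightarrow> k \<le> l \<Longrightarrow> packing_bound X x R s l"
  unfolding packing_bound_def by (meson order_trans)

text \<open>Finitely many balls of radius s/2 cover the compact ball, and each contains at most one
  point of an s-separated set.\<close>

lemma proper_packing_bound:
  assumes "proper_metric X" and "x \<in> mspace X" and "s > 0"
  shows "\<exists>k. packing_bound X x R s k"
proof -
  let ?B = "mcball_of X x R"
  have comp: "compactin (mtopology_of X) ?B"
    using assms by (simp add: proper_metric_def)
  have "\<exists>\<F>. finite \<F> \<and> \<F> \<subseteq> (\<lambda>y. mball_of X y (s/2)) ` ?B \<and> ?B \<subseteq> \<Union>\<F>"
  proof (rule compactinD [OF comp])
    show "openin (mtopology_of X) U" if "U \<in> (\<lambda>y. mball_of X y (s/2)) ` ?B" for U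
      using that by (auto simp: mtopology_of_def mball_of_def Metric_space.openin_mball)
    show "?B \<subseteq> \<Union>((\<lambda>y. mball_of X y (s/2)) ` ?B)"
    proof
      fix y assume "y \<in> ?B"
      then show "y \<in> \<Union>((\<lambda>y. mball_of X y (s/2)) ` ?B)"
        using \<open>s > 0\<close> by (intro UN_I [of y]) (simp_all add: mdist_self)
    qed
  qed
  then obtain C where C: "finite C" "C \<subseteq> ?B" "?B \<subseteq> (\<Union>y\<in>C. mball_of X y (s/2))"
    by (metis finite_subset_image)
  show ?thesis
  proof (intro exI, unfold packing_bound_def, intro allI impI, elim conjE)
    fix S assume S: "finite S" "S \<subseteq> mball_of X x R" "\<forall>y\<in>S. \<forall>z\<in>S. y \<noteq> z \<longrightarrow> mdist X y z > s"
    have "\<forall>y\<in>S. \<exists>c\<in>C. y \<in> mball_of X c (s/2)"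
    proof
      fix y assume "y \<in> S"
      then have "y \<in> ?B"
        using S(2) by auto
      then show "\<exists>c\<in>C. y \<in> mball_of X c (s/2)"
        using C(3) by blast
    qed
    then obtain c where c: "\<And>y. y \<in> S \<Longrightarrow> c y \<in> C \<and> y \<in> mball_of X (c y) (s/2)"
      by metis
    have "inj_on c S"
    proof (rule inj_onI, rule ccontr)
      fix y z assume yz: "y \<in> S" "z \<in> S" "c y = c z" "y \<noteq> z"
      have mem: "y \<in> mspace X" "z \<in> mspace X" "c y \<in> mspace X"
        using c [OF yz(1)] c [OF yz(2)] by auto
      have "mdist X y z \<le> mdist X y (c y) + mdist X (c y) z"
        using mem by (intro mdist_triangle)
      also have "\<dots> < s"
        using c [OF yz(1)] c [OF yz(2)] yz(3) by (simp add: mdist_commute)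
      finally show False
        using S(3) yz by fastforce
    qed
    then show "card S \<le> card C"
      using c C(1) by (intro card_inj_on_le) auto
  qed
qed

text \<open>Gromov--Hausdorff convergence enters only here: approximate isometries carry a separated
  set of a late member of the sequence to a separated set of one fixed late member.\<close>

lemma uniform_packing_bound:
  assumes proper: "\<And>i. proper_metric (X i)" and p: "\<And>i. p i \<in> mspace (X i)"
    and q: "q \<in> mspace Y" and conv: "pointed_GH_converges X p Y q"
    and "R > 0" and "s > 0"
  shows "\<exists>k. \<forall>i. packing_bound (X i) (p i) R s k"
proof -
  \<comment> \<open>Transport costs \<epsilon> for each of the two maps and 2\<epsilon> for choosing
    preimages, and s - 4\<epsilon> = s/2. The radius grows by 2\<epsilon> so that images of the
    R-ball stay within \<open>R' - \<epsilon>\<close> of q, where the second map is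
    \<epsilon>-dense.\<close>
  define \<epsilon> where "\<epsilon> = s / 8"
  define R' where "R' = R + 2 * \<epsilon>"
  have "\<epsilon> > 0" "R' > 0"
    using \<open>R > 0\<close> \<open>s > 0\<close> by (simp_all add: \<epsilon>_def R'_def)
  define approx where "approx i f \<longleftrightarrow> f \<in> mball_of (X i) (p i) R' \<rightarrow> mspace Y \<and> f (p i) = q \<and>
      (\<forall>x \<in> mball_of (X i) (p i) R'. \<forall>y \<in> mball_of (X i) (p i) R'.
         \<bar>mdist Y (f x) (f y) - mdist (X i) x y\<bar> < \<epsilon>) \<and>
      (\<forall>z \<in> mball_of Y q (R' - \<epsilon>). \<exists>x \<in> mball_of (X i) (p i) R'. mdist Y (f x) z < \<epsilon>)" for i f
  have "\<forall>\<^sub>F i in sequentially. \<exists>f. approx i f"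
    using conv \<open>\<epsilon> > 0\<close> \<open>R' > 0\<close> unfolding pointed_GH_converges_def approx_def by (simp only: Bex_def conj_assoc)
  then obtain i\<^sub>0 where i\<^sub>0: "\<And>i. i \<ge> i\<^sub>0 \<Longrightarrow> \<exists>f. approx i f"
    by (auto simp: eventually_sequentially)
  obtain f\<^sub>0 where f\<^sub>0: "approx i\<^sub>0 f\<^sub>0"
    using i\<^sub>0 by blast
  \<comment> \<open>The comparison space is a member of the sequence because compactness of balls is
    given there, not for \<open>Y\<close>.\<close>
  obtain k\<^sub>0 where k\<^sub>0: "packing_bound (X i\<^sub>0) (p i\<^sub>0) R' (s/2) k\<^sub>0"
    using proper_packing_bound [OF proper p] \<open>s > 0\<close> by (metis half_gt_zero)
  have late: "packing_bound (X i) (p i) R s k\<^sub>0" if i: "i \<ge> i\<^sub>0" for i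
    unfolding packing_bound_def
  proof (intro allI impI, elim conjE)
    fix S assume S: "finite S" "S \<subseteq> mball_of (X i) (p i) R"
      "\<forall>y\<in>S. \<forall>z\<in>S. y \<noteq> z \<longrightarrow> mdist (X i) y z > s"
    obtain f where f: "approx i f"
      using i\<^sub>0 [OF i] by blast
    have S': "y \<in> mball_of (X i) (p i) R'" if "y \<in> S" for y
      using S(2) that \<open>\<epsilon> > 0\<close> by (auto simp: R'_def dest!: subsetD)
    have fY: "f y \<in> mspace Y" if "y \<in> S" for y
      using f S' [OF that] by (auto simp: approx_def)
    have "\<exists>x \<in> mball_of (X i\<^sub>0) (p i\<^sub>0) R'. mdist Y (f\<^sub>0 x) (f y) < \<epsilon>" if y: "y \<in> S" for y
    proof -
      have "p i \<in> mball_of (X i) (p i) R'"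
        using p \<open>R' > 0\<close> by (simp add: mdist_self)
      then have "\<bar>mdist Y (f (p i)) (f y) - mdist (X i) (p i) y\<bar> < \<epsilon>"
        using f S' [OF y] unfolding approx_def by blast
      moreover have "mdist (X i) (p i) y < R"
        using S(2) y by auto
      moreover have "f (p i) = q"
        using f by (simp add: approx_def)
      ultimately have "f y \<in> mball_of Y q (R' - \<epsilon>)"
        using q fY [OF y] by (simp add: R'_def)
      then show ?thesis
        using f\<^sub>0 unfolding approx_def by blast
    qed
    then obtain g where g: "\<And>y. y \<in> S \<Longrightarrow> g y \<in> mball_of (X i\<^sub>0) (p i\<^sub>0) R'"
      "\<And>y. y \<in> S \<Longrightarrow> mdist Y (f\<^sub>0 (g y)) (f y) < \<epsilon>"
      by metis
    have sep: "mdist (X i\<^sub>0) (g y) (g z) > s/2" if yz: "y \<in> S" "z \<in> S" "y \<noteq> z" for y z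
    proof -
      have Y: "f\<^sub>0 (g y) \<in> mspace Y" "f\<^sub>0 (g z) \<in> mspace Y"
        using f\<^sub>0 g(1) yz by (auto simp: approx_def Pi_iff)
      have "mdist Y (f y) (f z) \<le> mdist Y (f y) (f\<^sub>0 (g y)) + mdist Y (f\<^sub>0 (g y)) (f z)"
        by (intro mdist_triangle fY Y yz)
      also have "mdist Y (f\<^sub>0 (g y)) (f z) \<le> mdist Y (f\<^sub>0 (g y)) (f\<^sub>0 (g z)) + mdist Y (f\<^sub>0 (g z)) (f z)"
        by (intro mdist_triangle fY Y yz)
      finally have "mdist Y (f y) (f z) \<le> 2 * \<epsilon> + mdist Y (f\<^sub>0 (g y)) (f\<^sub>0 (g z))"
        using g(2) [OF yz(1)] g(2) [OF yz(2)] by (simp add: mdist_commute)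
      moreover have "\<bar>mdist Y (f\<^sub>0 (g y)) (f\<^sub>0 (g z)) - mdist (X i\<^sub>0) (g y) (g z)\<bar> < \<epsilon>"
        using f\<^sub>0 g(1) yz unfolding approx_def by blast
      moreover have "\<bar>mdist Y (f y) (f z) - mdist (X i) y z\<bar> < \<epsilon>"
        using f S' yz unfolding approx_def by blast
      moreover have "mdist (X i) y z > s"
        using S(3) yz by blast
      ultimately show ?thesis
        unfolding \<epsilon>_def by linarith
    qed
    have "inj_on g S"
    proof (rule inj_onI, rule ccontr)
      fix y z assume yz: "y \<in> S" "z \<in> S" "g y = g z" "y \<noteq> z"
      have "g z \<in> mspace (X i\<^sub>0)"
        using g(1) [OF yz(2)] by simp
      then show False
        using sep [OF yz(1,2,4)] \<open>s > 0\<close> by (simp add: yz(3) mdist_self)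
    qed
    moreover have "card (g ` S) \<le> k\<^sub>0"
    proof -
      have "\<forall>y\<in>g ` S. \<forall>z\<in>g ` S. y \<noteq> z \<longrightarrow> mdist (X i\<^sub>0) y z > s/2"
        using sep by blast
      then show ?thesis
        using k\<^sub>0 g(1) S(1) unfolding packing_bound_def
        by (elim allE [of _ "g ` S"]) (simp add: image_subset_iff)
    qed
    ultimately show "card S \<le> k\<^sub>0"
      by (simp add: card_image)
  qed
  have "\<forall>i. \<exists>k. packing_bound (X i) (p i) R s k"
    using proper_packing_bound [OF proper p \<open>s > 0\<close>] by blast
  then obtain k where k: "\<And>i. packing_bound (X i) (p i) R s (k i)"
    by metis
  \<comment> \<open>The finitely many early spaces contribute their own packing numbers.\<close>
  have "packing_bound (X i) (p i) R s (Max (insert k\<^sub>0 (k ` {..<i\<^sub>0})))" for i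
  proof (cases "i \<ge> i\<^sub>0")
    case True
    then show ?thesis
      by (intro packing_bound_mono [OF late]) auto
  next
    case False
    then show ?thesis
      by (intro packing_bound_mono [OF k]) auto
  qed
  then show ?thesis
    by blast
qed

section \<open>Orbit distances, and the passage from isometry groups to integer coordinates\<close>

lemma orbit_dist_less_imp:
  assumes "orbit_dist X A B < t" and "A \<noteq> {}" "B \<noteq> {}"
  obtains a b where "a \<in> A" "b \<in> B" "mdist X a b < t"
proof -
  have "Inf ((\<lambda>(a, b). mdist X a b) ` (A \<times> B)) < t"
    using assms(1) by (simp add: orbit_dist_def)
  then obtain v where "v \<in> (\<lambda>(a, b). mdist X a b) ` (A \<times> B)" "v < t"
    using cInf_lessD [of "(\<lambda>(a, b). mdist X a b) ` (A \<times> B)" t] assms(2,3) by auto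
  then show thesis
    using that by auto
qed

lemma orbit_dist_le:
  assumes "a \<in> A" "b \<in> B"
  shows "orbit_dist X A B \<le> mdist X a b"
proof -
  have "bdd_below ((\<lambda>(a, b). mdist X a b) ` (A \<times> B))"
    by (rule bdd_belowI [of _ 0]) auto
  then show ?thesis
    unfolding orbit_dist_def using assms by (intro cInf_lower) force+
qed

lemma orbit_space_eq: "orbit_space X G = (\<lambda>x. (\<lambda>g. g x) ` G) ` mspace X"
  by (auto simp: orbit_space_def orbits_def orbit_def image_def)

lemma isometry_group_mult:
  "g \<in> isometries X \<Longrightarrow> h \<in> isometries X \<Longrightarrow> g \<otimes>\<^bsub>isometry_group X\<^esub> h = compose (mspace X) g h"
  by (simp add: isometry_group_def BijGroup_def isometries_def)

lemma carrier_isometry_group: "carrier (isometry_group X) = isometries X"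
  by (simp add: isometry_group_def)

lemma one_isometry_group: "\<one>\<^bsub>isometry_group X\<^esub> = (\<lambda>x\<in>mspace X. x)"
  by (simp add: isometry_group_def BijGroup_def)

lemma isometries_mem: "g \<in> isometries X \<Longrightarrow> x \<in> mspace X \<Longrightarrow> g x \<in> mspace X"
  by (auto simp: isometries_def dest: Bij_imp_funcset)

lemma isometries_mdist:
  "g \<in> isometries X \<Longrightarrow> x \<in> mspace X \<Longrightarrow> y \<in> mspace X \<Longrightarrow> mdist X (g x) (g y) = mdist X x y"
  by (simp add: isometries_def)

text \<open>The distance of the two orbits is an infimum, so some pair realizes it only up to slack;
  \<open>D\<close> < 2 * \<open>D\<close> provides that. Applying the inverse of g moves the first
  point back to x.\<close>

lemma quotient_diam_le_imp_dense:
  assumes G: "subgroup G (isometry_group X)" and diam: "quotient_diam X G \<le> ennreal D" and "D > 0"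
    and x: "x \<in> mspace X" and p: "p \<in> mspace X"
  shows "\<exists>g\<in>G. mdist X x (g p) \<le> 2 * D"
proof -
  interpret group "isometry_group X"
    by (rule group_isometry_group)
  have Giso: "G \<subseteq> isometries X"
    using subgroup.subset [OF G] by (simp add: carrier_isometry_group)
  let ?o = "\<lambda>x. (\<lambda>g. g x) ` G"
  have "(?o x, ?o p) \<in> orbit_space X G \<times> orbit_space X G"
    using x p by (auto simp: orbit_space_eq)
  then have "ennreal (orbit_dist X (?o x) (?o p)) \<le> quotient_diam X G"
    unfolding quotient_diam_def by (rule SUP_upper2) simp
  also note diam
  finally have "orbit_dist X (?o x) (?o p) < 2 * D"
    using \<open>D > 0\<close> by (simp add: ennreal_le_iff)
  moreover have "G \<noteq> {}"
    using subgroup.one_closed [OF G] by blast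
  ultimately obtain a b where "a \<in> ?o x" "b \<in> ?o p" "mdist X a b < 2 * D"
    using orbit_dist_less_imp [of X "?o x" "?o p" "2 * D"] by auto
  then obtain g h where gh: "g \<in> G" "h \<in> G" "mdist X (g x) (h p) < 2 * D"
    by auto
  define g' where "g' = inv\<^bsub>isometry_group X\<^esub> g"
  have g': "g' \<in> G"
    unfolding g'_def using subgroup.m_inv_closed [OF G] gh by blast
  have iso: "g \<in> isometries X" "h \<in> isometries X" "g' \<in> isometries X"
    using Giso gh g' by auto
  have "g' (g x) = x"
  proof -
    have "g' \<otimes>\<^bsub>isometry_group X\<^esub> g = \<one>\<^bsub>isometry_group X\<^esub>"
      unfolding g'_def using iso by (intro l_inv) (simp add: carrier_isometry_group)
    then have "compose (mspace X) g' g x = (\<lambda>x\<in>mspace X. x) x"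
      using iso by (simp add: isometry_group_mult one_isometry_group)
    then show ?thesis
      using x by (simp add: compose_def)
  qed
  moreover have "mdist X (g' (g x)) (g' (h p)) = mdist X (g x) (h p)"
    by (rule isometries_mdist [OF iso(3) isometries_mem [OF iso(1) x] isometries_mem [OF iso(2) p]])
  ultimately have "mdist X x (g' (h p)) \<le> 2 * D"
    using gh by simp
  moreover have "g' (h p) = (g' \<otimes>\<^bsub>isometry_group X\<^esub> h) p"
    using iso p by (simp add: isometry_group_mult compose_def)
  moreover have "g' \<otimes>\<^bsub>isometry_group X\<^esub> h \<in> G"
    using subgroup.m_closed [OF G g' gh(2)] .
  ultimately show ?thesis
    by metis
qed

lemma group_Zpow: "group (Zpow n)"
  by (simp add: Zpow_def)

lemma restrict_mem_Zpow: "restrict v {1..n} \<in> carrier (Zpow n)"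
  by (simp add: Zpow_def)

lemma restrict_add_Zpow:
  "restrict (v + w) {1..n} = restrict v {1..n} \<otimes>\<^bsub>Zpow n\<^esub> restrict w {1..n}"
  by (auto simp: Zpow_def restrict_def)

lemma restrict_zero_Zpow: "restrict 0 {1..n} = \<one>\<^bsub>Zpow n\<^esub>"
  by (auto simp: Zpow_def restrict_def)

text \<open>The bound for a single space, in terms of \<open>D\<close>, k and
  \<open>j\<^sub>0\<close> only, which gives uniformity. An isomorphism of the big group with Z^n
  turns it into coordinates, in which the generators of \<Gamma> become the rows of an integer
  matrix.\<close>

lemma quotient_diam_lattice_le:
  fixes n k j\<^sub>0 :: nat
  assumes "D > 0" and p: "p \<in> mspace X"
    and geo: "geodesic_metric X" and sc: "simply_connected_space (mtopology_of X)"
    and G: "subgroup G (isometry_group X)"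
    and \<Gamma>: "subgroup \<Gamma> ((isometry_group X)\<lparr>carrier := G\<rparr>)"
    and G_iso: "(isometry_group X)\<lparr>carrier := G\<rparr> \<cong> Zpow n"
    and \<phi>: "\<phi> \<in> iso (Zpow n) ((isometry_group X)\<lparr>carrier := \<Gamma>\<rparr>)"
    and short: "\<And>j. j \<in> {1..n} \<Longrightarrow> mdist X (\<phi> (Zbasis n j) p) p \<le> 2 * D"
    and diam: "quotient_diam X G \<le> ennreal D"
    and packing: "packing_bound X p (17 * D) (8 * D) k"
    and "j\<^sub>0 \<ge> 1" and j\<^sub>0: "512 * 8^k \<le> (1 - cos (pi/10)) * 4^j\<^sub>0"
  shows "quotient_diam X \<Gamma> \<le> ennreal (4 * D + (8 * D * 2^((k + 1) * j\<^sub>0 + 1) + 1))"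
proof -
  let ?I = "isometry_group X"
  let ?G = "?I\<lparr>carrier := G\<rparr>"
  let ?\<Gamma> = "?I\<lparr>carrier := \<Gamma>\<rparr>"
  define J where "J = {1..n}"
  have J: "finite J"
    by (simp add: J_def)
  have Giso: "G \<subseteq> isometries X"
    using subgroup.subset [OF G] by (simp add: carrier_isometry_group)
  have \<Gamma>G: "\<Gamma> \<subseteq> G"
    using subgroup.subset [OF \<Gamma>] by simp
  have grpG: "group ?G"
    by (rule group.subgroup_imp_group [OF group_isometry_group G])
  obtain \<psi> where \<psi>: "\<psi> \<in> iso ?G (Zpow n)"
    using G_iso by (auto simp: is_iso_def)
  define \<phi>G where "\<phi>G = inv_into G \<psi>"
  have \<phi>G: "\<phi>G \<in> iso (Zpow n) ?G"
    using group.iso_set_sym [OF grpG \<psi>] by (simp add: \<phi>G_def)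
  have \<psi>\<phi>G: "\<phi>G (\<psi> g) = g" if "g \<in> G" for g
    using \<psi> that by (simp add: \<phi>G_def iso_iff inv_into_f_f)
  \<comment> \<open>Total functions form an \<open>ab_group_add\<close>, unlike the extensional ones
    in \<open>Zpow\<close>; the price is that \<rho> ignores all entries outside
    \<open>J\<close>.\<close>
  define \<rho> where "\<rho> v = \<phi>G (restrict v J)" for v :: "nat \<Rightarrow> int"
  have \<rho>G: "\<rho> v \<in> G" for v
    using hom_in_carrier [OF iso_imp_homomorphism [OF \<phi>G] restrict_mem_Zpow, of v] by (simp add: \<rho>_def J_def)
  then have \<rho>iso: "\<rho> v \<in> isometries X" for v
    using Giso by blast
  have \<rho>_add: "\<rho> (v + w) = compose (mspace X) (\<rho> v) (\<rho> w)" for v w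
  proof -
    have "\<rho> (v + w) = \<rho> v \<otimes>\<^bsub>?I\<^esub> \<rho> w"
      using hom_mult [OF iso_imp_homomorphism [OF \<phi>G] restrict_mem_Zpow restrict_mem_Zpow, of v w]
      by (simp add: \<rho>_def J_def restrict_add_Zpow del: One_nat_def)
    then show ?thesis
      by (simp add: isometry_group_mult \<rho>iso)
  qed
  have \<rho>_zero: "\<rho> 0 = (\<lambda>x\<in>mspace X. x)"
    using hom_one [OF iso_imp_homomorphism [OF \<phi>G] group_Zpow grpG]
    by (simp add: \<rho>_def J_def restrict_zero_Zpow one_isometry_group del: One_nat_def)
  have \<rho>_cong: "\<rho> v = \<rho> w" if "\<And>k. k \<in> J \<Longrightarrow> v k = w k" for v w
    unfolding \<rho>_def using that by (metis restrict_ext)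
  define \<sigma> where "\<sigma> a = \<phi> (restrict a J)" for a :: "nat \<Rightarrow> int"
  have \<sigma>\<Gamma>: "\<sigma> a \<in> \<Gamma>" for a
    using hom_in_carrier [OF iso_imp_homomorphism [OF \<phi>] restrict_mem_Zpow, of a] by (simp add: \<sigma>_def J_def)
  have \<sigma>_add: "\<sigma> (a + b) = \<sigma> a \<otimes>\<^bsub>?I\<^esub> \<sigma> b" for a b
    using hom_mult [OF iso_imp_homomorphism [OF \<phi>] restrict_mem_Zpow restrict_mem_Zpow, of a b]
    by (simp add: \<sigma>_def J_def restrict_add_Zpow del: One_nat_def)
  \<comment> \<open>The coordinates in the big group of the element of \<Gamma> with exponent vector
    a; on unit vectors this gives the matrix w.\<close>
  define W where "W a k = (if k \<in> J then \<psi> (\<sigma> a) k else 0)" for a k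
  have \<rho>W: "\<rho> (W a) = \<sigma> a" for a
  proof -
    have "\<psi> (\<sigma> a) \<in> carrier (Zpow n)"
      using hom_in_carrier [OF iso_imp_homomorphism [OF \<psi>], of "\<sigma> a"] \<sigma>\<Gamma> \<Gamma>G by auto
    then have "restrict (W a) J = \<psi> (\<sigma> a)"
      by (auto simp: W_def J_def Zpow_def PiE_iff extensional_def restrict_def)
    then show ?thesis
      using \<psi>\<phi>G \<sigma>\<Gamma> \<Gamma>G by (auto simp: \<rho>_def)
  qed
  have W_add: "W (a + b) k = W a k + W b k" for a b k
  proof -
    have "\<psi> (\<sigma> a \<otimes>\<^bsub>?G\<^esub> \<sigma> b) = \<psi> (\<sigma> a) \<otimes>\<^bsub>Zpow n\<^esub> \<psi> (\<sigma> b)"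
      by (rule hom_mult [OF iso_imp_homomorphism [OF \<psi>]]) (use \<sigma>\<Gamma> \<Gamma>G in auto)
    then show ?thesis
      by (simp add: W_def \<sigma>_add Zpow_def J_def)
  qed
  have W_cong: "W a = W b" if "\<And>k. k \<in> J \<Longrightarrow> a k = b k" for a b
  proof -
    have "restrict a J = restrict b J"
      using that by (rule restrict_ext)
    then show ?thesis
      unfolding W_def \<sigma>_def by (simp only:)
  qed
  define e where "e j k = (if k = j then 1 else 0 :: int)" for j k :: nat
  define w where "w j = W (e j)" for j
  have W_expand: "W a k = (\<Sum>j\<in>J. a j * w j k)" for a k
  proof -
    have "W a = W (\<lambda>k. \<Sum>j\<in>J. a j * e j k)"
    proof (rule W_cong)
      fix k assume "k \<in> J"
      have "(\<Sum>j\<in>J. a j * e j k) = (\<Sum>j\<in>J. if j = k then a k else 0)"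
        by (intro sum.cong) (auto simp: e_def)
      then show "a k = (\<Sum>j\<in>J. a j * e j k)"
        using J \<open>k \<in> J\<close> by simp
    qed
    then show ?thesis
      using additive_lincomb [of "\<lambda>a. W a k" J a e] W_add J by (simp add: w_def)
  qed
  \<comment> \<open>A relation among the rows would give two exponent vectors of the same element of
    \<Gamma>, against injectivity of \<phi>. Thus full rank, and with it finite index, comes from
    the equal ranks.\<close>
  have indep: "\<forall>j\<in>J. a j = 0" if zero: "\<And>k. k \<in> J \<Longrightarrow> (\<Sum>j\<in>J. a j * w j k) = 0" for a
  proof -
    have "W a k = W 0 k" for k
    proof (cases "k \<in> J")
      case True
      then show ?thesis
        using zero [OF True] by (simp add: W_expand)
    qed (simp add: W_def)
    then have "W a = W 0"
      by (rule ext)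
    then have "\<sigma> a = \<sigma> 0"
      using \<rho>W [of a] \<rho>W [of 0] by simp
    moreover have "inj_on \<phi> (carrier (Zpow n))"
      using \<phi> by (simp add: iso_iff)
    ultimately have "restrict a J = restrict 0 J"
      unfolding \<sigma>_def J_def by (meson inj_onD restrict_mem_Zpow)
    then show ?thesis
      by (metis restrict_apply' zero_fun_apply)
  qed
  obtain M B where M: "M > (0::nat)" and MB:
    "\<forall>v. \<forall>k\<in>J. int M * v k = (\<Sum>j\<in>J. (\<Sum>i\<in>J. v i * B i j) * w j k)"
    "\<forall>i\<in>J. \<forall>j\<in>J. (\<Sum>l\<in>J. w i l * B l j) = (if i = j then int M else 0)"
    using exists_rational_coordinates [of J w, OF J] indep by auto
  note expand = MB(1) [rule_format] and dual = MB(2) [rule_format]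
  \<comment> \<open>B / M inverts the matrix w, so on \<open>J\<close> each v is the combination of
    the rows w j with coefficients c j v.\<close>
  define c where "c j v = real_of_int (\<Sum>i\<in>J. v i * B i j) / real M" for j and v :: "nat \<Rightarrow> int"
  have Mc: "real M * c j v = real_of_int (\<Sum>i\<in>J. v i * B i j)" for j v
    using M by (simp add: c_def)
  interpret coordinatized_action X \<rho> p D J c M
  proof
    show "\<exists>g. mdist X x (\<rho> g p) \<le> 2 * D" if x: "x \<in> mspace X" for x
    proof -
      obtain g where g: "g \<in> G" "mdist X x (g p) \<le> 2 * D"
        using quotient_diam_le_imp_dense [OF G diam \<open>D > 0\<close> x p] by blast
      have "\<psi> g \<in> carrier (Zpow n)"
        using hom_in_carrier [OF iso_imp_homomorphism [OF \<psi>], of g] g by simp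
      then have "\<rho> (\<psi> g) = g"
        using \<psi>\<phi>G [OF g(1)] by (simp add: \<rho>_def J_def Zpow_def PiE_restrict)
      then show ?thesis
        using g by metis
    qed
    show "\<rho> (g + h) x = \<rho> g (\<rho> h x)" if "x \<in> mspace X" for g h x
      using that by (simp add: \<rho>_add compose_def)
    show "c j (x + y) = c j x + c j y" for j x y
      by (simp add: c_def distrib_right sum.distrib add_divide_distrib)
    show "real M * c j x \<in> \<int>" for j x
      unfolding Mc by (rule Ints_of_int)
    show "\<rho> g x \<in> mspace X" if "x \<in> mspace X" for g x
      by (rule isometries_mem [OF \<rho>iso that])
    show "mdist X (\<rho> g x) (\<rho> g y) = mdist X x y" if "x \<in> mspace X" "y \<in> mspace X" for g x y
      by (rule isometries_mdist [OF \<rho>iso that])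
  qed (use \<open>D > 0\<close> p geo J M \<rho>_zero in simp_all)
  have lat_\<Gamma>: "\<rho> l \<in> \<Gamma>" if l: "l \<in> lat" for l
  proof -
    have "\<forall>j\<in>J. \<exists>m. c j l = of_int m"
      using l by (auto simp: lat_def elim!: Ints_cases)
    then obtain a where a: "\<And>j. j \<in> J \<Longrightarrow> c j l = of_int (a j)"
      by metis
    have "l k = W a k" if k: "k \<in> J" for k
    proof -
      have coeff: "(\<Sum>i\<in>J. l i * B i j) = int M * a j" if "j \<in> J" for j
      proof -
        have "real_of_int (\<Sum>i\<in>J. l i * B i j) = real_of_int (int M * a j)"
          unfolding Mc [symmetric] a [OF that] by simp
        then show ?thesis
          by (simp only: of_int_eq_iff)
      qed
      have "int M * l k = (\<Sum>j\<in>J. (int M * a j) * w j k)"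
        unfolding expand [OF k] using coeff by simp
      also have "\<dots> = int M * W a k"
        by (simp add: W_expand sum_distrib_left mult.assoc)
      finally show ?thesis
        using M by simp
    qed
    then have "\<rho> l = \<sigma> a"
      using \<rho>_cong \<rho>W by metis
    then show ?thesis
      using \<sigma>\<Gamma> by simp
  qed
  have w_lat: "w i \<in> lat" if i: "i \<in> J" for i
    unfolding lat_def
  proof (intro CollectI ballI)
    fix j assume "j \<in> J"
    then show "c j (w i) \<in> \<int>"
      using M unfolding c_def dual [OF i \<open>j \<in> J\<close>] by auto
  qed
  have w_short: "N (w i) \<le> 2 * D" if "i \<in> J" for i
  proof -
    have "restrict (e i) J = Zbasis n i"
      by (auto simp: e_def Zbasis_def J_def restrict_def)
    then have "\<rho> (w i) = \<phi> (Zbasis n i)"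
      using \<rho>W [of "e i"] by (simp add: w_def \<sigma>_def)
    then show ?thesis
      using short that by (simp add: N_def J_def)
  qed
  \<comment> \<open>Vectors supported outside \<open>J\<close> act trivially; they have to be
    counted as lattice elements of norm 0.\<close>
  have vanishing: "z \<in> lat \<and> N z = 0" if "\<And>k. k \<in> J \<Longrightarrow> z k = 0" for z
  proof -
    have "\<rho> z = \<rho> 0"
      using that by (intro \<rho>_cong) simp
    then have "N z = 0"
      using N_zero by (simp add: N_def)
    moreover have "c j z = 0" for j
      using that by (simp add: c_def)
    ultimately show ?thesis
      by (simp add: lat_def)
  qed
  \<comment> \<open>Elements of norm at most 16D give points in the open ball of radius 17D, the one
    used in the packing hypothesis.\<close>
  have codiam: "\<exists>l\<in>lat. N (g + l) \<le> 8 * D * 2^((k + 1) * j\<^sub>0 + 1) + 1" for g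
  proof (rule lattice_codiameter [OF sc _ \<open>j\<^sub>0 \<ge> 1\<close> j\<^sub>0])
    fix S assume S: "finite S" "\<And>g. g \<in> S \<Longrightarrow> N g \<le> 16 * D"
      "\<And>g h. g \<in> S \<Longrightarrow> h \<in> S \<Longrightarrow> g \<noteq> h \<Longrightarrow> N (g - h) > 8 * D"
    have inj: "inj_on (\<lambda>g. \<rho> g p) S"
    proof (rule inj_onI, rule ccontr)
      fix g h assume "g \<in> S" "h \<in> S" "\<rho> g p = \<rho> h p" "g \<noteq> h"
      then show False
        using S(3) [of g h] \<open>D > 0\<close> by (simp add: N_diff mdist_self act_mem p)
    qed
    have "card ((\<lambda>g. \<rho> g p) ` S) \<le> k"
    proof -
      have "(\<lambda>g. \<rho> g p) ` S \<subseteq> mball_of X p (17 * D)"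
        using S(2) \<open>D > 0\<close> by (fastforce simp: N_def act_mem p mdist_commute)
      moreover have "\<forall>y\<in>(\<lambda>g. \<rho> g p) ` S. \<forall>z\<in>(\<lambda>g. \<rho> g p) ` S. y \<noteq> z \<longrightarrow> mdist X y z > 8 * D"
        using S(3) unfolding N_diff by blast
      ultimately show ?thesis
        using packing S(1) unfolding packing_bound_def
        by (elim allE [of _ "(\<lambda>g. \<rho> g p) ` S"]) simp
    qed
    then show "card S \<le> k"
      by (simp add: card_image inj)
  next
    fix \<Lambda> :: "(nat \<Rightarrow> int) \<Rightarrow> real" and v
    assume \<Lambda>: "\<And>g h. \<Lambda> (g + h) = \<Lambda> g + \<Lambda> h" "\<And>g. g \<in> lat \<Longrightarrow> N g \<le> 2 * D \<Longrightarrow> \<Lambda> g = 0"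
    \<comment> \<open>\<open>M\<close> times v is an integral combination s of the short generators
      plus a vector z vanishing on \<open>J\<close>. \<Lambda> kills both, hence v.\<close>
    define b where "b j = (\<Sum>i\<in>J. v i * B i j)" for j
    define s where "s = (\<lambda>k. \<Sum>j\<in>J. b j * w j k)"
    define z where "z = (\<lambda>k. int M * v k) - s"
    have "z \<in> lat \<and> N z = 0"
      by (rule vanishing) (simp add: z_def s_def b_def expand)
    then have "\<Lambda> z = 0"
      using \<open>D > 0\<close> by (intro \<Lambda>(2)) auto
    moreover have "\<Lambda> (\<lambda>k. int M * v k) = \<Lambda> z + \<Lambda> s"
      using \<Lambda>(1) [of z s] by (simp add: z_def)
    moreover have "\<Lambda> s = 0"
      unfolding s_def additive_lincomb [of \<Lambda>, OF \<Lambda>(1) J] using \<Lambda>(2) w_lat w_short by simp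
    ultimately have "real M * \<Lambda> v = 0"
      using additive_scale [of \<Lambda> "int M" v, OF \<Lambda>(1)] by simp
    then show "\<Lambda> v = 0"
      using M by simp
  qed
  show ?thesis
    unfolding quotient_diam_def
  proof (rule SUP_least, clarify)
    fix A B assume "A \<in> orbit_space X \<Gamma>" "B \<in> orbit_space X \<Gamma>"
    then obtain x y where x: "x \<in> mspace X" "A = (\<lambda>g. g x) ` \<Gamma>" and y: "y \<in> mspace X" "B = (\<lambda>g. g y) ` \<Gamma>"
      by (auto simp: orbit_space_eq)
    obtain g h where g: "mdist X x (\<rho> g p) \<le> 2 * D" and h: "mdist X y (\<rho> h p) \<le> 2 * D"
      using dense x y by metis
    obtain l where l: "l \<in> lat" "N ((g - h) + l) \<le> 8 * D * 2^((k + 1) * j\<^sub>0 + 1) + 1"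
      using codiam by blast
    \<comment> \<open>Orbit points near x and y are g p and h p. Moving x by the lattice element l
      brings g p within the codiameter bound of h p, and the two approximations cost 2D
      each.\<close>
    have "(g - h) + l = (l + g) - h"
      by (simp add: algebra_simps)
    then have "mdist X (\<rho> (l + g) p) (\<rho> h p) \<le> 8 * D * 2^((k + 1) * j\<^sub>0 + 1) + 1"
      using l(2) N_diff by metis
    then have lg: "mdist X (\<rho> l (\<rho> g p)) (\<rho> h p) \<le> 8 * D * 2^((k + 1) * j\<^sub>0 + 1) + 1"
      by (simp add: act_add p)
    have "\<rho> 0 \<in> \<Gamma>"
      using lat_\<Gamma> lat_zero by blast
    then have "y \<in> B"
      using y \<rho>_zero by (force simp: image_iff)
    moreover have "\<rho> l x \<in> A"
      using x lat_\<Gamma> [OF l(1)] by blast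
    ultimately have "orbit_dist X A B \<le> mdist X (\<rho> l x) y"
      by (intro orbit_dist_le)
    also have "\<dots> \<le> mdist X (\<rho> l x) (\<rho> l (\<rho> g p)) + mdist X (\<rho> l (\<rho> g p)) y"
      by (intro mdist_triangle act_mem p x y)
    also have "mdist X (\<rho> l (\<rho> g p)) y \<le> mdist X (\<rho> l (\<rho> g p)) (\<rho> h p) + mdist X (\<rho> h p) y"
      by (intro mdist_triangle act_mem p x y)
    finally have "orbit_dist X A B \<le> 4 * D + (8 * D * 2^((k + 1) * j\<^sub>0 + 1) + 1)"
      using g h lg by (simp add: act_dist act_mem p x mdist_commute)
    then show "ennreal (orbit_dist X A B) \<le> ennreal (4 * D + (8 * D * 2^((k + 1) * j\<^sub>0 + 1) + 1))"
      by (rule ennreal_leI)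
  qed
qed

theorem theorem5:
  fixes n :: nat and D :: real
    and X :: "nat \<Rightarrow> 'a metric" and p :: "nat \<Rightarrow> 'a"
    and G \<Gamma> :: "nat \<Rightarrow> ('a \<Rightarrow> 'a) set"
    and Y :: "'b metric" and q :: 'b
  assumes "D > 0"
    and "\<And>i. p i \<in> mspace (X i)"
    and "\<And>i. proper_metric (X i)"
    and "\<And>i. geodesic_metric (X i)"
    and "\<And>i. simply_connected_space (mtopology_of (X i))"
    and "\<And>i. subgroup (G i) (isometry_group (X i))"
    and "\<And>i. subgroup (\<Gamma> i) ((isometry_group (X i))\<lparr>carrier := G i\<rparr>)"
    and "\<And>i. discrete_isometries (X i) (G i)"
    and "\<And>i. discrete_isometries (X i) (\<Gamma> i)"
    and "\<And>i. (isometry_group (X i))\<lparr>carrier := G i\<rparr> \<cong> Zpow n"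
    and "\<And>i. (isometry_group (X i))\<lparr>carrier := \<Gamma> i\<rparr> \<cong> Zpow n"
    and "\<And>i. quotient_diam (X i) (G i) \<le> ennreal D"
    and "\<And>i g. g \<in> \<Gamma> i - {\<one>\<^bsub>isometry_group (X i)\<^esub>} \<Longrightarrow> mdist (X i) (g (p i)) (p i) \<ge> D"
    and "\<And>i. \<exists>\<phi> \<in> iso (Zpow n) ((isometry_group (X i))\<lparr>carrier := \<Gamma> i\<rparr>).
           \<forall>j \<in> {1..n}. mdist (X i) (\<phi> (Zbasis n j) (p i)) (p i) \<le> 2 * D"
    and "q \<in> mspace Y"
    and "pointed_GH_converges X p Y q"
  shows "(SUP i. quotient_diam (X i) (\<Gamma> i)) < \<infinity>"
proof -
  \<comment> \<open>Radius and separation come from covering the 16D-ball by 8D-balls, that is 4r by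
    2r, with 17D leaving room for an open ball.\<close>
  obtain k where k: "\<And>i. packing_bound (X i) (p i) (17 * D) (8 * D) k"
    using uniform_packing_bound [of X p q Y "17 * D" "8 * D"] assms by auto
  define c\<^sub>0 where "c\<^sub>0 = 1 - cos (pi/10)"
  have "c\<^sub>0 > 0"
    using cos_monotone_0_pi [of 0 "pi/10"] by (simp add: c\<^sub>0_def)
  obtain m :: nat where m: "512 * 8^k / c\<^sub>0 < 4^m"
    using real_arch_pow [of 4] by auto
  \<comment> \<open>The exponent \<open>Suc m\<close> is used as \<open>j\<^sub>0\<close>, which
    must be at least 1.\<close>
  have "512 * 8^k \<le> c\<^sub>0 * 4^Suc m"
  proof -
    have "512 * 8^k < c\<^sub>0 * 4^m"
      using m \<open>c\<^sub>0 > 0\<close> by (simp add: field_simps)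
    also have "\<dots> \<le> c\<^sub>0 * 4^Suc m"
      using \<open>c\<^sub>0 > 0\<close> by simp
    finally show ?thesis
      by simp
  qed
  then have j\<^sub>0: "512 * 8^k \<le> (1 - cos (pi/10)) * 4^Suc m"
    by (simp only: c\<^sub>0_def)
  have "quotient_diam (X i) (\<Gamma> i) \<le> ennreal (4 * D + (8 * D * 2^((k + 1) * Suc m + 1) + 1))" for i
  proof -
    obtain \<phi> where \<phi>: "\<phi> \<in> iso (Zpow n) ((isometry_group (X i))\<lparr>carrier := \<Gamma> i\<rparr>)"
      "\<And>j. j \<in> {1..n} \<Longrightarrow> mdist (X i) (\<phi> (Zbasis n j) (p i)) (p i) \<le> 2 * D"
      using assms(14) by blast
    show ?thesis
      by (rule quotient_diam_lattice_le [OF assms(1,2,4,5,6,7,10) \<phi> assms(12) k _ j\<^sub>0]) auto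
  qed
  then have "(SUP i. quotient_diam (X i) (\<Gamma> i)) \<le> ennreal (4 * D + (8 * D * 2^((k + 1) * Suc m + 1) + 1))"
    by (rule SUP_least)
  also have "\<dots> < \<infinity>"
    by simp
  finally show ?thesis .
qed

end
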